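(* Let $f:[0,1]\to\mathbb{R}$ be a non-zero $L^1$ function whose Fourier series is a pure cosine series without constant term, $$f(t)\sim\sum_{m=1}^{\infty}a_m\cos(2\pi m t),$$ and suppose there are constants $M$ and $\beta>\frac12$ such that $|a_m|<\frac{M}{m^{\beta}}$ for all $m\ge 1$. Let $T:[0,1]\to[0,1]$, $T(\alpha)=2\alpha \bmod 1$, and equip $[0,1]$ with the uniform distribution (Lebesgue measure). For $k\ge 0$ let $X_k^f(\alpha)=f(T^k(\alpha))$, and for $n\ge 1$ let $$A_n=\frac{X_0^f+X_1^f+\cdots+X_{n-1}^f}{n},\qquad \mu=\int_0^1 f(t)\,dt,\qquad \sigma_n^2=\operatorname{Var}\bigl(X_0^f+X_1^f+\cdots+X_{n-1}^f\bigr).$$ Assume that the limit $\lim_{n\to\infty}\frac{\sigma_n^2}{n}=\sigma^2$ exists and that $\sigma^2>0$. Define (for all $n$ with $\sigma_n>0$, hence for all large $n$) $$W_n^f=\frac{A_n-\mu}{\sigma_n/n}=\frac{X_0^f+\cdots+X_{n-1}^f-n\mu}{\sigma_n}.$$ Then $W_n^f$ converges to the standard normal random variable in the Wasserstein metric, i.e. $\lim_{n\to\infty}d_W(W_n^f,Z)=0$, where $Z$ is a standard normal random variable.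
   Context: The Fourier hypothesis $f(t)\sim\sum_{m\ge1}a_m\cos(2\pi m t)$ means: $\int_0^1 f(t)\,dt=0$, $\int_0^1 f(t)\sin(2\pi m t)\,dt=0$ for all $m\ge1$ (the 1-periodic extension of $f$ is even), and $a_m=2\int_0^1 f(t)\cos(2\pi m t)\,dt$. The decay condition on $a_m$ with $\beta>\frac12$ implies $f\in L^2([0,1])$, so that the variances are finite. The Wasserstein metric between real random variables $X,Y$ (with finite first moments) is $d_W(X,Y)=\sup\{\mathbb{E}[h(X)]-\mathbb{E}[h(Y)] : h:\mathbb{R}\to\mathbb{R}\ \text{1-Lipschitz}\}$. *)

theory Defs
  imports "HOL-Probability.Probability"
begin

abbreviation unit_space :: "real measure"
  where "unit_space \<equiv> lebesgue_on {0..1}"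

lemma prob_space_unit_space: "prob_space unit_space"
  by (rule prob_spaceI) (simp add: emeasure_restrict_space)

text \<open>\<open>f \<sim> (\<Sum>m\<ge>1. a m * cos (2 * pi * m * t))\<close>: the Fourier series of the \<open>L\<^sup>1\<close> function \<open>f\<close> on
  \<open>[0,1]\<close> is this pure cosine series, with no constant term. No convergence is claimed, and
  \<open>a 0\<close> is irrelevant.\<close>

definition has_cosine_series :: "(real \<Rightarrow> real) \<Rightarrow> (nat \<Rightarrow> real) \<Rightarrow> bool" where
  "has_cosine_series f a \<longleftrightarrow>
     (\<integral>t. f t \<partial>unit_space) = 0 \<and>
     (\<forall>m\<ge>1. (\<integral>t. f t * sin (2 * pi * real m * t) \<partial>unit_space) = 0) \<and>
     (\<forall>m\<ge>1. a m = 2 * (\<integral>t. f t * cos (2 * pi * real m * t) \<partial>unit_space))"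

definition doubling :: "real \<Rightarrow> real"
  where "doubling \<alpha> = frac (2 * \<alpha>)"

definition orbit_var :: "(real \<Rightarrow> real) \<Rightarrow> nat \<Rightarrow> real \<Rightarrow> real"
  where "orbit_var f k \<alpha> = f ((doubling ^^ k) \<alpha>)"

definition orbit_avg :: "(real \<Rightarrow> real) \<Rightarrow> nat \<Rightarrow> real \<Rightarrow> real"
  where "orbit_avg f n \<alpha> = (\<Sum>k<n. orbit_var f k \<alpha>) / real n"

definition orbit_mean :: "(real \<Rightarrow> real) \<Rightarrow> real"
  where "orbit_mean f = (\<integral>t. f t \<partial>unit_space)"

definition orbit_sd :: "(real \<Rightarrow> real) \<Rightarrow> nat \<Rightarrow> real"
  where "orbit_sd f n = sqrt (prob_space.variance unit_space (\<lambda>\<alpha>. \<Sum>k<n. orbit_var f k \<alpha>))"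

text \<open>Meaningful when \<open>orbit_sd f n > 0\<close>; otherwise the quotient is \<open>0\<close> by convention, which does
  not affect limits as \<open>n \<rightarrow> \<infinity>\<close> when \<open>orbit_sd f n > 0\<close> eventually.\<close>

definition orbit_normalized :: "(real \<Rightarrow> real) \<Rightarrow> nat \<Rightarrow> real \<Rightarrow> real"
  where "orbit_normalized f n \<alpha> = (orbit_avg f n \<alpha> - orbit_mean f) / (orbit_sd f n / real n)"

text \<open>The Wasserstein distance of real random variables \<open>X\<close> on \<open>M\<close> and \<open>Y\<close> on \<open>N\<close> with finite first
  moments. The supremum is taken in \<^typ>\<open>ereal\<close>, so that it needs no boundedness proof.\<close>

definition wasserstein_dist ::
    "'a measure \<Rightarrow> ('a \<Rightarrow> real) \<Rightarrow> 'b measure \<Rightarrow> ('b \<Rightarrow> real) \<Rightarrow> ereal" where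
  "wasserstein_dist M X N Y =
     (SUP h \<in> {h :: real \<Rightarrow> real. 1-lipschitz_on UNIV h}.
        ereal ((\<integral>\<omega>. h (X \<omega>) \<partial>M) - (\<integral>\<omega>. h (Y \<omega>) \<partial>N)))"

end

theory Submission
  imports Defs
begin

text \<open>
  Since \<open>\<sigma>\<^sup>2 > 0\<close>, the Birkhoff sums are square integrable, hence so is \<open>f\<close>, and \<open>f\<close> is the limit in
  \<open>L\<^sup>2\<close> of its cosine polynomials \<open>P\<^sub>K\<close>. For \<open>g = f - P\<^sub>K\<close> the correlation of \<open>g\<close> with
  \<open>g \<circ> T\<^sup>j\<close> is \<open>\<Sum>l. a (2^j * l) * a l / 2\<close>, which decays like \<open>2 powr (- j * \<beta>)\<close> with a factor that
  tends to \<open>0\<close> as \<open>K\<close> grows because \<open>\<beta> > 1/2\<close>; so replacing \<open>f\<close> by \<open>P\<^sub>K\<close> costs a small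
  proportion of the variance. A Birkhoff sum of the Lipschitz function \<open>P\<^sub>K\<close> is cut into blocks of length \<open>p\<close>,
  and each block sum is replaced by a function of its own \<open>p\<close> binary digits, with an error that is bounded
  independently of \<open>p\<close> and almost uncorrelated along the blocks, hence negligible for large \<open>p\<close>.
  As \<open>T\<close> shifts the binary digits, the new blocks are independent and identically distributed, so their
  characteristic functions converge to that of a normal law. Convergence of the characteristic functions
  together with bounded second moments gives Wasserstein convergence, by Skorohod's theorem.
\<close>

section \<open>Birkhoff sums of square integrable functions\<close>

text \<open>Only an L2 approximation of \<open>f\<close> is at hand, and the crude bound for the
  second moment of a Birkhoff sum grows like \<open>n^2\<close>, whereas the norming divides by
  \<open>n\<close>. The decay of the coefficients is spent on replacing \<open>n^2\<close> by
  \<open>n\<close> times a small factor: \<open>T^j\<close> multiplies frequencies by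
  \<open>2^j\<close>, so orthogonality pairs \<open>a l\<close> only with
  \<open>a (2^j * l)\<close>. The parameters are nested: the degree \<open>K\<close> determines a
  Lipschitz constant, the block length \<open>p\<close> is chosen against that constant, and
  \<open>n\<close> grows last; this is why the error per block must not depend on \<open>p\<close>.
  The variance of a block is never computed. The normalised sum has second moment 1 for large
  \<open>n\<close>, and a block sum close to it in L2 must have a limiting variance close to
  1.\<close>

definition sq_integrable :: "'a measure \<Rightarrow> ('a \<Rightarrow> real) \<Rightarrow> bool" where
  "sq_integrable M g \<longleftrightarrow> g \<in> borel_measurable M \<and> integrable M (\<lambda>x. (g x)\<^sup>2)"

lemma sq_integrableI:
  assumes "g \<in> borel_measurable M" "integrable M (\<lambda>x. (g x)\<^sup>2)"
  shows "sq_integrable M g"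
  using assms by (simp add: sq_integrable_def)

lemma sq_integrable_measurable: "sq_integrable M g \<Longrightarrow> g \<in> borel_measurable M"
  and sq_integrable_square: "sq_integrable M g \<Longrightarrow> integrable M (\<lambda>x. (g x)\<^sup>2)"
  by (simp_all add: sq_integrable_def)

lemma abs_mult_le_sum_squares: "\<bar>x * y\<bar> \<le> x\<^sup>2 + (y::real)\<^sup>2"
proof -
  have "2 * (\<bar>x\<bar> * \<bar>y\<bar>) \<le> x\<^sup>2 + y\<^sup>2"
    using sum_squares_bound[of "\<bar>x\<bar>" "\<bar>y\<bar>"] by (simp add: mult.assoc)
  then show ?thesis
    by (simp add: abs_mult) (smt (verit) mult_nonneg_nonneg abs_ge_zero)
qed

lemma square_add_le: "(x + y)\<^sup>2 \<le> 2 * x\<^sup>2 + 2 * (y::real)\<^sup>2"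
  using sum_squares_bound[of x y] by (simp add: power2_sum)

lemma sq_integrable_mult:
  assumes "sq_integrable M g" "sq_integrable M h"
  shows "integrable M (\<lambda>x. g x * h x)"
proof (rule Bochner_Integration.integrable_bound)
  show "integrable M (\<lambda>x. (g x)\<^sup>2 + (h x)\<^sup>2)"
    using assms by (auto simp: sq_integrable_def)
  show "(\<lambda>x. g x * h x) \<in> borel_measurable M"
    using assms by (auto simp: sq_integrable_def)
  show "AE x in M. norm (g x * h x) \<le> norm ((g x)\<^sup>2 + (h x)\<^sup>2)"
    using abs_mult_le_sum_squares by (auto simp: abs_mult)
qed

lemma sq_integrable_cmult: "sq_integrable M g \<Longrightarrow> sq_integrable M (\<lambda>x. c * g x)"
  by (auto simp: sq_integrable_def power_mult_distrib)

lemma sq_integrable_divide: "sq_integrable M g \<Longrightarrow> sq_integrable M (\<lambda>x. g x / c)"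
  using sq_integrable_cmult[of M g "inverse c"] by (simp add: field_simps)

lemma sq_integrable_add:
  assumes "sq_integrable M g" "sq_integrable M h"
  shows "sq_integrable M (\<lambda>x. g x + h x)"
proof (rule sq_integrableI)
  show "(\<lambda>x. g x + h x) \<in> borel_measurable M"
    using assms by (auto simp: sq_integrable_def)
  have "integrable M (\<lambda>x. (g x)\<^sup>2 + (h x)\<^sup>2 + 2 * (g x * h x))"
    using assms sq_integrable_mult[OF assms] by (auto simp: sq_integrable_def)
  then show "integrable M (\<lambda>x. (g x + h x)\<^sup>2)"
    by (simp add: power2_sum mult.assoc)
qed

lemma sq_integrable_diff:
  assumes "sq_integrable M g" "sq_integrable M h"
  shows "sq_integrable M (\<lambda>x. g x - h x)"
  using sq_integrable_add[OF assms(1) sq_integrable_cmult[OF assms(2), of "-1"]] by simp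

lemma sq_integrable_zero: "sq_integrable M (\<lambda>x. 0)"
  by (auto simp: sq_integrable_def)

lemma sq_integrable_sum:
  assumes "\<And>i. i \<in> I \<Longrightarrow> sq_integrable M (g i)"
  shows "sq_integrable M (\<lambda>x. \<Sum>i\<in>I. g i x)"
  using assms
  by (induction I rule: infinite_finite_induct) (auto intro: sq_integrable_add sq_integrable_zero)

lemma sq_integrable_bounded:
  assumes "finite_measure M" "g \<in> borel_measurable M" "\<And>x. x \<in> space M \<Longrightarrow> \<bar>g x\<bar> \<le> B"
  shows "sq_integrable M g"
proof (rule sq_integrableI)
  show "integrable M (\<lambda>x. (g x)\<^sup>2)"
  proof (rule finite_measure.integrable_const_bound[OF assms(1), where B="B\<^sup>2"])
    show "AE x in M. norm ((g x)\<^sup>2) \<le> B\<^sup>2"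
    proof (rule AE_I2)
      fix x assume "x \<in> space M"
      then have "\<bar>g x\<bar> ^ 2 \<le> B ^ 2"
        using assms(3) by (intro power_mono) auto
      then show "norm ((g x)\<^sup>2) \<le> B\<^sup>2" by simp
    qed
  qed (use assms in auto)
qed fact

lemma sq_integrable_integrable:
  "finite_measure M \<Longrightarrow> sq_integrable M g \<Longrightarrow> integrable M g"
  by (auto simp: sq_integrable_def intro: finite_measure.square_integrable_imp_integrable)

lemma integral_square_add_le:
  assumes "sq_integrable M g" "sq_integrable M h"
  shows "(\<integral>x. (g x + h x)\<^sup>2 \<partial>M) \<le> 2 * (\<integral>x. (g x)\<^sup>2 \<partial>M) + 2 * (\<integral>x. (h x)\<^sup>2 \<partial>M)"
proof -
  have "(\<integral>x. (g x + h x)\<^sup>2 \<partial>M) \<le> (\<integral>x. 2 * (g x)\<^sup>2 + 2 * (h x)\<^sup>2 \<partial>M)"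
    using assms sq_integrable_add[OF assms]
    by (intro integral_mono) (auto simp: sq_integrable_def square_add_le)
  also have "\<dots> = 2 * (\<integral>x. (g x)\<^sup>2 \<partial>M) + 2 * (\<integral>x. (h x)\<^sup>2 \<partial>M)"
    using assms by (auto simp: sq_integrable_def)
  finally show ?thesis .
qed

section \<open>Second moments of Birkhoff sums under a measure preserving map\<close>

locale measure_preserving =
  fixes M :: "'a measure" and \<tau> :: "'a \<Rightarrow> 'a"
  assumes meas [measurable]: "\<tau> \<in> measurable M M"
    and distr_eq: "distr M M \<tau> = M"
begin

lemma integral_comp:
  fixes g :: "'a \<Rightarrow> 'b::{banach, second_countable_topology}"
  assumes "g \<in> borel_measurable M"
  shows "(\<integral>x. g (\<tau> x) \<partial>M) = (\<integral>x. g x \<partial>M)"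
  using integral_distr[OF meas, of g] assms by (simp add: distr_eq)

lemma integrable_comp:
  fixes g :: "'a \<Rightarrow> 'b::{banach, second_countable_topology}"
  assumes "g \<in> borel_measurable M"
  shows "integrable M (\<lambda>x. g (\<tau> x)) \<longleftrightarrow> integrable M g"
  using integrable_distr_eq[OF meas, of g] assms by (simp add: distr_eq)

lemma sq_integrable_comp: "sq_integrable M g \<Longrightarrow> sq_integrable M (\<lambda>x. g (\<tau> x))"
  using integrable_comp[of "\<lambda>x. (g x)\<^sup>2"] measurable_compose[OF meas, of g]
  by (auto simp: sq_integrable_def)

text \<open>Makes the results of the locale available for the block map
  \<open>doubling ^^ p\<close>.\<close>

lemma funpow: "measure_preserving M (\<tau> ^^ k)"
proof (induction k)
  case 0
  show ?case by (simp add: measure_preserving_def id_def)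
next
  case (Suc k)
  then interpret k: measure_preserving M "\<tau> ^^ k" .
  have "distr M M (\<tau> \<circ> \<tau> ^^ k) = M"
    using distr_distr[OF meas k.meas] by (simp add: distr_eq k.distr_eq)
  then show ?case
    by (auto simp: measure_preserving_def o_def intro: measurable_compose[OF k.meas meas])
qed

lemma sq_integrable_funpow: "sq_integrable M g \<Longrightarrow> sq_integrable M (\<lambda>x. g ((\<tau> ^^ k) x))"
  using measure_preserving.sq_integrable_comp[OF funpow] .

lemma integral_funpow:
  fixes g :: "'a \<Rightarrow> 'b::{banach, second_countable_topology}"
  shows "g \<in> borel_measurable M \<Longrightarrow> (\<integral>x. g ((\<tau> ^^ k) x) \<partial>M) = (\<integral>x. g x \<partial>M)"
  using measure_preserving.integral_comp[OF funpow] .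

lemma sq_integrable_birkhoff:
  "sq_integrable M g \<Longrightarrow> sq_integrable M (\<lambda>x. \<Sum>j<n. g ((\<tau> ^^ j) x))"
  by (intro sq_integrable_sum sq_integrable_funpow)

text \<open>Splitting off the first term leaves a Birkhoff sum composed with \<open>\<tau>\<close>,
  whose second moment is unchanged by invariance; all new correlations then start at
  \<open>g\<close> itself.\<close>

lemma integral_birkhoff_Suc:
  assumes "sq_integrable M g"
  shows "(\<integral>x. (\<Sum>j<Suc n. g ((\<tau> ^^ j) x))\<^sup>2 \<partial>M)
    = (\<integral>x. (g x)\<^sup>2 \<partial>M) + 2 * (\<Sum>j<n. \<integral>x. g x * g ((\<tau> ^^ Suc j) x) \<partial>M)
      + (\<integral>x. (\<Sum>j<n. g ((\<tau> ^^ j) x))\<^sup>2 \<partial>M)"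
proof -
  define S where "S n x = (\<Sum>j<n. g ((\<tau> ^^ j) x))" for n x
  have S: "S (Suc n) x = g x + S n (\<tau> x)" for x
    unfolding S_def sum.lessThan_Suc_shift by (simp add: funpow_swap1)
  have [simp]: "sq_integrable M (S n)"
    using sq_integrable_birkhoff[OF assms] unfolding S_def .
  have sh: "sq_integrable M (\<lambda>x. S n (\<tau> x))"
    by (intro sq_integrable_comp) simp
  have "(\<integral>x. (S (Suc n) x)\<^sup>2 \<partial>M)
      = (\<integral>x. (g x)\<^sup>2 + 2 * (g x * S n (\<tau> x)) + (S n (\<tau> x))\<^sup>2 \<partial>M)"
    unfolding S by (simp add: power2_sum algebra_simps)
  also have "\<dots> = (\<integral>x. (g x)\<^sup>2 \<partial>M) + 2 * (\<integral>x. g x * S n (\<tau> x) \<partial>M) + (\<integral>x. (S n (\<tau> x))\<^sup>2 \<partial>M)"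
    using assms sh sq_integrable_mult[OF assms sh] by (simp add: sq_integrable_def)
  also have "(\<integral>x. (S n (\<tau> x))\<^sup>2 \<partial>M) = (\<integral>x. (S n x)\<^sup>2 \<partial>M)"
    using sq_integrable_measurable[of M "S n"] by (intro integral_comp) simp
  also have "(\<integral>x. g x * S n (\<tau> x) \<partial>M) = (\<integral>x. (\<Sum>j<n. g x * g ((\<tau> ^^ Suc j) x)) \<partial>M)"
    by (simp add: S_def sum_distrib_left funpow_swap1)
  also have "\<dots> = (\<Sum>j<n. \<integral>x. g x * g ((\<tau> ^^ Suc j) x) \<partial>M)"
    by (intro Bochner_Integration.integral_sum sq_integrable_mult assms sq_integrable_funpow)
  finally show ?thesis unfolding S_def .
qed

text \<open>Decay of correlations turns quadratic growth in \<open>n\<close> into linear growth.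
  Each further term adds its second moment, at most \<open>C\<close> by the case
  \<open>j = 0\<close>, and twice a geometric series of correlations.\<close>

lemma birkhoff_square_bound:
  assumes g: "sq_integrable M g" and r: "0 \<le> r" "r < 1" and C: "C \<ge> 0"
    and corr: "\<And>j. \<bar>\<integral>x. g x * g ((\<tau> ^^ j) x) \<partial>M\<bar> \<le> C * r ^ j"
  shows "(\<integral>x. (\<Sum>j<n. g ((\<tau> ^^ j) x))\<^sup>2 \<partial>M) \<le> real n * (2 * C / (1 - r))"
proof (induction n)
  case (Suc n)
  have "(\<Sum>j<n. \<integral>x. g x * g ((\<tau> ^^ Suc j) x) \<partial>M) \<le> (\<Sum>j<n. C * r ^ Suc j)"
    using corr by (intro sum_mono) (meson abs_le_D1)
  also have "\<dots> = C * r * (\<Sum>j<n. r ^ j)"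
    by (simp add: sum_distrib_left mult.assoc)
  also have "\<dots> \<le> C * r * (1 / (1 - r))"
  proof -
    have "(\<Sum>j<n. r ^ j) \<le> (\<Sum>j. r ^ j)"
      using r by (intro sum_le_suminf) auto
    also have "\<dots> = 1 / (1 - r)"
      using r by (intro suminf_geometric) auto
    finally show ?thesis
      using r C by (intro mult_left_mono) auto
  qed
  finally have 1: "(\<Sum>j<n. \<integral>x. g x * g ((\<tau> ^^ Suc j) x) \<partial>M) \<le> C * r / (1 - r)" by simp
  have 2: "(\<integral>x. (g x)\<^sup>2 \<partial>M) \<le> C"
    using corr[of 0] by (simp add: power2_eq_square)
  have "C + 2 * (C * r / (1 - r)) = C * (1 + r) / (1 - r)"
    using r by (simp add: field_simps)
  also have "\<dots> \<le> 2 * C / (1 - r)"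
    using r C by (intro divide_right_mono) (auto simp: algebra_simps mult_left_le)
  finally have "C + 2 * (C * r / (1 - r)) \<le> 2 * C / (1 - r)" .
  moreover have "real (Suc n) * (2 * C / (1 - r)) = real n * (2 * C / (1 - r)) + 2 * C / (1 - r)"
    by (simp add: distrib_right add_divide_distrib)
  ultimately show ?case
    unfolding integral_birkhoff_Suc[OF g] using 1 2 Suc by linarith
qed simp

lemma birkhoff_square_orthogonal:
  assumes g: "sq_integrable M g"
    and orth: "\<And>j. (\<integral>x. g x * g ((\<tau> ^^ Suc j) x) \<partial>M) = 0"
  shows "(\<integral>x. (\<Sum>j<n. g ((\<tau> ^^ j) x))\<^sup>2 \<partial>M) = real n * (\<integral>x. (g x)\<^sup>2 \<partial>M)"
proof (induction n)
  case (Suc n)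
  then show ?case unfolding integral_birkhoff_Suc[OF g] by (simp only: orth) (simp add: algebra_simps)
qed simp

text \<open>Too weak for the limit in \<open>n\<close>; it serves where \<open>n\<close> is fixed
  and the second moment of \<open>g\<close> tends to 0.\<close>

lemma birkhoff_square_trivial_bound:
  assumes g: "sq_integrable M g"
  shows "(\<integral>x. (\<Sum>j<n. g ((\<tau> ^^ j) x))\<^sup>2 \<partial>M) \<le> (real n)\<^sup>2 * (\<integral>x. (g x)\<^sup>2 \<partial>M)"
proof -
  have "(\<integral>x. (\<Sum>j<n. g ((\<tau> ^^ j) x))\<^sup>2 \<partial>M) \<le> (\<integral>x. real n * (\<Sum>j<n. (g ((\<tau> ^^ j) x))\<^sup>2) \<partial>M)"
  proof (rule integral_mono)
    show "integrable M (\<lambda>x. (\<Sum>j<n. g ((\<tau> ^^ j) x))\<^sup>2)"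
      using sq_integrable_birkhoff[OF g] by (rule sq_integrable_square)
    show "integrable M (\<lambda>x. real n * (\<Sum>j<n. (g ((\<tau> ^^ j) x))\<^sup>2))"
      using sq_integrable_square[OF sq_integrable_funpow[OF g]] by simp
    show "(\<Sum>j<n. g ((\<tau> ^^ j) x))\<^sup>2 \<le> real n * (\<Sum>j<n. (g ((\<tau> ^^ j) x))\<^sup>2)" for x
      using Cauchy_Schwarz_ineq_sum[of "\<lambda>_. 1" "\<lambda>j. g ((\<tau> ^^ j) x)" "{..<n}"] by simp
  qed
  also have "\<dots> = real n * (\<Sum>j<n. \<integral>x. (g ((\<tau> ^^ j) x))\<^sup>2 \<partial>M)"
    using sq_integrable_square[OF sq_integrable_funpow[OF g]]
    by (subst integral_mult_right_zero) (subst Bochner_Integration.integral_sum, auto)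
  also have "\<dots> = (real n)\<^sup>2 * (\<integral>x. (g x)\<^sup>2 \<partial>M)"
    using integral_funpow[of "\<lambda>x. (g x)\<^sup>2"] sq_integrable_measurable[OF g]
    by (simp add: power2_eq_square)
  finally show ?thesis .
qed

end

section \<open>The doubling map and binary digits\<close>

abbreviation birkhoff :: "(real \<Rightarrow> real) \<Rightarrow> nat \<Rightarrow> real \<Rightarrow> real" where
  "birkhoff f n x \<equiv> \<Sum>k<n. f ((doubling ^^ k) x)"

interpretation unit: prob_space unit_space
  by (rule prob_space_unit_space)

lemma finite_measure_unit_space: "finite_measure unit_space"
  by unfold_locales

lemma borel_unit_space [measurable_dest]:
  "g \<in> borel_measurable borel \<Longrightarrow> g \<in> borel_measurable unit_space"
  by (intro measurable_restrict_space1 measurable_completion) simp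

text \<open>Up to one point, the preimage of a set consists of two copies of it at half scale, one
  in each half of the interval, and each copy has half the measure.\<close>

lemma doubling_measure_preserving: "measure_preserving unit_space doubling"
proof -
  have aff: "(\<lambda>x. t + c * x) \<in> lebesgue \<rightarrow>\<^sub>M lebesgue" if "c \<noteq> 0" for t c :: real
    using lebesgue_affine_measurable[of "\<lambda>_. c" t] that by simp
  have main: "doubling -` A \<inter> {0..1} \<in> sets lebesgue \<and>
      emeasure lebesgue (doubling -` A \<inter> {0..1}) = emeasure lebesgue A"
    if A: "A \<in> sets lebesgue" "A \<subseteq> {0..1}" for A
  proof -
    \<comment> \<open>\<open>doubling\<close> never takes the value 1 and sends the end point 1 to
      0. So the point 1 is split off on both sides: from \<open>A\<close> here, from the preimage in
      \<open>P\<close>.\<close>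
    define B where "B = A \<inter> {0..<1}"
    define E where "E d = (\<lambda>x. (1/2) *\<^sub>R x + d) ` B" for d :: real
    define P where "P = doubling -` A \<inter> {1}"
    have B: "B \<in> sets lebesgue" using A by (auto simp: B_def)
    have E_eq: "E d = (\<lambda>x. (- 2 * d) + 2 * x) -` B \<inter> space lebesgue" for d
    proof (intro set_eqI iffI)
      fix x assume "x \<in> (\<lambda>x. (- 2 * d) + 2 * x) -` B \<inter> space lebesgue"
      then have "2 * x - 2 * d \<in> B" by (simp add: algebra_simps)
      then show "x \<in> E d" unfolding E_def by (rule rev_image_eqI) (simp add: field_simps)
    qed (auto simp: E_def)
    have E [measurable]: "E d \<in> sets lebesgue" for d
      unfolding E_eq using aff[of 2 "- 2 * d"] B by (intro measurable_sets) auto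
    have mE: "emeasure lebesgue (E d) = emeasure lebesgue B / 2" for d
      unfolding E_def by (subst emeasure_lebesgue_affine)
        (simp add: divide_ennreal_def mult.commute inverse_ennreal[symmetric] inverse_eq_divide
           flip: ennreal_numeral)
    have P: "P \<in> sets lebesgue" "emeasure lebesgue P = 0"
      by (cases "doubling 1 \<in> A"; auto simp: P_def vimage_def)+
    have dE: "doubling -` A \<inter> {0..1} = (E 0 \<union> E (1/2)) \<union> P"
    proof (intro set_eqI iffI)
      fix x assume x: "x \<in> doubling -` A \<inter> {0..1}"
      then consider "x < 1/2" "0 \<le> x" | "1/2 \<le> x" "x < 1" | "x = 1" by force
      then show "x \<in> (E 0 \<union> E (1/2)) \<union> P"
      proof cases
        case 1
        then have "doubling x = 2 * x" by (simp add: doubling_def frac_eq)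
        then show ?thesis using x 1 by (auto simp: E_eq B_def)
      next
        case 2
        then have "doubling x = 2 * x - 1" by (simp add: doubling_def frac_unique_iff)
        then show ?thesis using x 2 by (auto simp: E_eq B_def)
      qed (use x in \<open>auto simp: P_def\<close>)
    next
      fix x assume "x \<in> (E 0 \<union> E (1/2)) \<union> P"
      then consider "x \<in> E 0" | "x \<in> E (1/2)" | "x \<in> P" by blast
      then show "x \<in> doubling -` A \<inter> {0..1}"
      proof cases
        case 1
        then have "doubling x = 2 * x" by (simp add: doubling_def frac_eq E_eq B_def)
        then show ?thesis using 1 by (auto simp: E_eq B_def)
      next
        case 2
        then have "doubling x = 2 * x - 1" by (simp add: doubling_def frac_unique_iff E_eq B_def)
        then show ?thesis using 2 by (auto simp: E_eq B_def)
      qed (auto simp: P_def)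
    qed
    have "emeasure lebesgue (doubling -` A \<inter> {0..1}) = emeasure lebesgue (E 0 \<union> E (1/2))"
      unfolding dE using P by (intro emeasure_Un_null_set) (auto simp: null_sets_def)
    also have "\<dots> = emeasure lebesgue (E 0) + emeasure lebesgue (E (1/2))"
    proof (rule plus_emeasure[symmetric])
      show "E 0 \<inter> E (1/2) = {}" by (auto simp: E_eq B_def)
    qed (rule E)+
    also have "\<dots> = emeasure lebesgue B"
      unfolding mE mult_2_right[symmetric] by (simp add: ennreal_divide_times)
    also have "\<dots> = emeasure lebesgue (B \<union> (A \<inter> {1}))"
      using B by (intro emeasure_Un_null_set[symmetric]) (cases "1 \<in> A"; auto)+
    also have "B \<union> (A \<inter> {1}) = A" using A by (force simp: B_def)
    finally show ?thesis unfolding dE using P by auto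
  qed
  have m: "doubling \<in> unit_space \<rightarrow>\<^sub>M unit_space"
  proof (rule measurableI)
    show "doubling x \<in> space unit_space" for x
      by (auto simp: doubling_def frac_lt_1 less_imp_le)
    show "doubling -` A \<inter> space unit_space \<in> sets unit_space" if "A \<in> sets unit_space" for A
      using main[of A] that by (auto simp: sets_restrict_space_iff)
  qed
  have "distr unit_space unit_space doubling = unit_space"
  proof (rule measure_eqI)
    fix A assume "A \<in> sets (distr unit_space unit_space doubling)"
    then have A: "A \<in> sets lebesgue" "A \<subseteq> {0..1}"
      by (auto simp: sets_restrict_space_iff)
    then show "emeasure (distr unit_space unit_space doubling) A = emeasure unit_space A"
      using m main[OF A]
      by (subst emeasure_distr) (auto simp: sets_restrict_space_iff emeasure_restrict_space)
  qed simp
  with m show ?thesis by unfold_locales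
qed

interpretation doubling: measure_preserving unit_space doubling
  by (rule doubling_measure_preserving)

lemma doubling_bounds: "doubling x \<in> {0..<1}"
  by (simp add: doubling_def frac_lt_1)

lemma doubling_funpow_diff_int: "\<exists>z::int. (doubling ^^ k) x = 2 ^ k * x - of_int z"
proof (induction k)
  case (Suc k)
  then obtain z :: int where z: "(doubling ^^ k) x = 2 ^ k * x - of_int z" by blast
  have "(doubling ^^ Suc k) x = doubling (2 ^ k * x - of_int z)" by (simp add: z)
  also have "\<dots> = 2 ^ Suc k * x - of_int (2 * z + \<lfloor>2 * (2 ^ k * x - of_int z)\<rfloor>)"
    by (simp add: doubling_def frac_def algebra_simps)
  finally show ?case by blast
qed (auto intro: exI[of _ 0])

text \<open>The point 1 is excluded because for \<open>k = 0\<close> it is not reduced modulo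
  1.\<close>

lemma doubling_funpow_eq_frac:
  assumes "x \<in> {0..<1}"
  shows "(doubling ^^ k) x = frac (2 ^ k * x)"
proof -
  obtain z :: int where "(doubling ^^ k) x = 2 ^ k * x - of_int z"
    using doubling_funpow_diff_int by blast
  moreover have "(doubling ^^ k) x \<in> {0..<1}"
    using assms doubling_bounds by (cases k) auto
  ultimately show ?thesis
    by (intro frac_unique_iff[THEN iffD2, symmetric]) auto
qed

lemma periodic_diff_int:
  fixes P :: "real \<Rightarrow> 'b"
  assumes "\<And>x. P (x + 1) = P x"
  shows "P (x - of_int z) = P x"
proof -
  have n: "P (y + of_nat n) = P y" for y n
  proof (induction n)
    case (Suc n)
    then show ?case using assms[of "y + of_nat n"] by (simp add: add.commute add.left_commute)
  qed simp
  show ?thesis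
    using n[of "x" "nat (- z)"] n[of "x - of_int z" "nat z"] by (cases "z \<ge> 0") auto
qed

lemma periodic_doubling_funpow:
  fixes P :: "real \<Rightarrow> 'b"
  assumes "\<And>x. P (x + 1) = P x"
  shows "P ((doubling ^^ k) x) = P (2 ^ k * x)"
proof -
  obtain z :: int where "(doubling ^^ k) x = 2 ^ k * x - of_int z"
    using doubling_funpow_diff_int by blast
  then show ?thesis using periodic_diff_int[of P, OF assms] by simp
qed

text \<open>Half-open pieces tile a half-open interval without overlap, so the end point 1 is
  discarded as a null set.\<close>

lemma has_bochner_integral_unit_space_Ico:
  fixes F :: "real \<Rightarrow> 'b::euclidean_space"
  shows "has_bochner_integral unit_space F i \<longleftrightarrow>
    has_bochner_integral lebesgue (\<lambda>x. indicator {0..<1} x *\<^sub>R F x) i"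
proof -
  have "has_bochner_integral unit_space F i \<longleftrightarrow>
      has_bochner_integral lebesgue (\<lambda>x. indicator {0..1} x *\<^sub>R F x) i"
    by (subst has_bochner_integral_restrict_space) auto
  also have "\<dots> \<longleftrightarrow> has_bochner_integral lebesgue (\<lambda>x. indicator {0..<1} x *\<^sub>R F x) i"
    by (rule has_bochner_integral_discrete_difference[where X="{1}"]) (auto simp: indicator_def)
  finally show ?thesis .
qed

text \<open>Change of variables on each of the \<open>N\<close> subintervals. With
  \<open>has_bochner_integral\<close> the integrability of \<open>F\<close> comes out together with
  the value.\<close>

lemma has_bochner_integral_unit_space_split:
  fixes F :: "real \<Rightarrow> 'b::euclidean_space"
  assumes N: "N > 0"
    and F: "\<And>i. i < N \<Longrightarrow> has_bochner_integral unit_space (\<lambda>y. F ((y + real i) / real N)) (I i)"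
  shows "has_bochner_integral unit_space F ((\<Sum>i<N. I i) /\<^sub>R real N)"
proof -
  have "has_bochner_integral lebesgue
      (\<lambda>x. indicator {real i / real N..<(real i + 1) / real N} x *\<^sub>R F x) (I i /\<^sub>R real N)"
    if "i < N" for i
  proof (subst has_bochner_integral_lebesgue_real_affine_iff[of "1 / real N" _ _ "real i / real N"])
    have "indicator {real i / real N..<(real i + 1) / real N} (real i / real N + 1 / real N * y)
        = (indicator {0..<1} y :: real)" for y
    proof -
      have "real i / real N + 1 / real N * y = (real i + y) / real N"
        by (simp add: add_divide_distrib)
      then show ?thesis using N by (auto simp: indicator_def divide_le_cancel divide_less_cancel)
    qed
    moreover have "real i / real N + 1 / real N * y = (y + real i) / real N" for y
      by (simp add: add_divide_distrib)
    ultimately show "has_bochner_integral lebesgue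
      (\<lambda>x. indicator {real i / real N..<(real i + 1) / real N} (real i / real N + 1 / real N * x) *\<^sub>R
         F (real i / real N + 1 / real N * x)) (I i /\<^sub>R real N /\<^sub>R \<bar>1 / real N\<bar>)"
      using F[OF that] N by (simp add: has_bochner_integral_unit_space_Ico)
  qed (use N in auto)
  then have "has_bochner_integral lebesgue
      (\<lambda>x. \<Sum>i<N. indicator {real i / real N..<(real i + 1) / real N} x *\<^sub>R F x) (\<Sum>i<N. I i /\<^sub>R real N)"
    by (intro has_bochner_integral_sum) auto
  moreover have "(\<Sum>i<N. indicator {real i / real N..<(real i + 1) / real N} x *\<^sub>R F x)
      = indicator {0..<1} x *\<^sub>R F x" for x
  proof -
    \<comment> \<open>Adjacent indicators merge one by one; the induction varies the number
      \<open>n\<close> of pieces while the mesh \<open>1 / N\<close> stays fixed.\<close>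
    have "(\<Sum>i<n. indicator {real i / real N..<(real i + 1) / real N} x)
      = (indicator {0..<real n / real N} x :: real)" for n
    proof (induction n)
      case (Suc n)
      have h: "real n / real N \<le> (real n + 1) / real N" "0 \<le> real n / real N"
        using N by (auto simp: divide_right_mono)
      have "indicator {0..<real n / real N} x + indicator {real n / real N..<(real n + 1) / real N} x
          = (indicator {0..<(real n + 1) / real N} x :: real)"
        using h(1) by (auto simp: indicator_def intro: order_trans[OF h(2)])
      then show ?case
        using Suc by (simp add: add.commute)
    qed simp
    from this[of N] show ?thesis using N by (simp flip: scaleR_sum_left)
  qed
  ultimately show ?thesis
    unfolding has_bochner_integral_unit_space_Ico by (simp add: scaleR_sum_right)
qed

text \<open>Truncation to the first \<open>p\<close> binary digits. That \<open>G\<close> depends on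
  these digits only is expressed as \<open>G x = G (dyadic_floor p x)\<close>.\<close>

definition dyadic_floor :: "nat \<Rightarrow> real \<Rightarrow> real" where
  "dyadic_floor p x = of_int \<lfloor>2 ^ p * x\<rfloor> / 2 ^ p"

lemma dyadic_floor_measurable [measurable]: "dyadic_floor p \<in> borel_measurable borel"
  unfolding dyadic_floor_def by measurable

lemma dyadic_floor_le: "dyadic_floor p x \<le> x"
  and dyadic_floor_ge: "x - 1 / 2 ^ p \<le> dyadic_floor p x"
proof -
  have "of_int \<lfloor>2 ^ p * x\<rfloor> \<le> 2 ^ p * x" "2 ^ p * x - 1 \<le> of_int \<lfloor>2 ^ p * x\<rfloor>"
    by linarith+
  then have "of_int \<lfloor>2 ^ p * x\<rfloor> / 2 ^ p \<le> 2 ^ p * x / 2 ^ p"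
    "(2 ^ p * x - 1) / 2 ^ p \<le> of_int \<lfloor>2 ^ p * x\<rfloor> / 2 ^ p"
    by (intro divide_right_mono; simp)+
  then show "dyadic_floor p x \<le> x" "x - 1 / 2 ^ p \<le> dyadic_floor p x"
    by (simp_all add: dyadic_floor_def diff_divide_distrib)
qed

text \<open>The nested floors reduce to integer division. A function of \<open>p\<close> digits is
  thereby also a function of any larger number of digits.\<close>

lemma dyadic_floor_dyadic_floor:
  assumes "p \<le> q"
  shows "dyadic_floor p (dyadic_floor q x) = dyadic_floor p x"
proof -
  have q: "(2::real) ^ q = 2 ^ p * of_int (2 ^ (q - p))"
    using assms by (simp flip: power_add)
  have "\<lfloor>2 ^ p * dyadic_floor q x\<rfloor> = \<lfloor>of_int \<lfloor>2 ^ q * x\<rfloor> / of_int (2 ^ (q - p)) :: real\<rfloor>"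
    unfolding dyadic_floor_def q by simp
  also have "\<dots> = \<lfloor>2 ^ q * x\<rfloor> div 2 ^ (q - p)"
    by (rule floor_divide_of_int_eq)
  also have "\<dots> = \<lfloor>2 ^ q * x / of_int (2 ^ (q - p))\<rfloor>"
    by (rule floor_divide_real_eq_div[symmetric]) simp
  also have "2 ^ q * x / of_int (2 ^ (q - p)) = 2 ^ p * x"
    unfolding q by simp
  finally show ?thesis by (simp add: dyadic_floor_def)
qed

text \<open>A function of the first \<open>p\<close> binary digits is independent of the point reached after \<open>p\<close>
  doublings.\<close>

lemma integral_dyadic_mult_doubling:
  fixes G H :: "real \<Rightarrow> 'b::{euclidean_space, real_normed_algebra}"
  assumes G: "\<And>x. x \<in> {0..<1} \<Longrightarrow> G x = G (dyadic_floor p x)" and H: "integrable unit_space H"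
  shows "has_bochner_integral unit_space (\<lambda>x. G x * H ((doubling ^^ p) x))
    ((\<integral>x. G x \<partial>unit_space) * (\<integral>x. H x \<partial>unit_space))"
proof -
  define N :: nat where "N = 2 ^ p"
  have N: "N > 0" "real N = 2 ^ p" by (simp_all add: N_def)
  \<comment> \<open>The \<open>i\<close>-th dyadic interval is parametrised by \<open>y\<close>:
    \<open>G\<close> is constant there, and \<open>p\<close> doublings return \<open>y\<close>. This
    may fail at \<open>y = 1\<close>, so functions are compared on \<open>{0..<1}\<close>
    only.\<close>
  have *: "(y + real i) / real N \<in> {0..<1}" "G ((y + real i) / real N) = G (real i / real N)"
    "(doubling ^^ p) ((y + real i) / real N) = y"
    if "y \<in> {0..<1}" "i < N" for y i
  proof -
    have "real i + 1 \<le> real N" using that by linarith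
    then show 1: "(y + real i) / real N \<in> {0..<1}" using that by (auto simp: divide_simps)
    have "\<lfloor>y + real i\<rfloor> = int i" using that by (intro floor_unique) auto
    then have "dyadic_floor p ((y + real i) / real N) = real i / real N"
      using N by (simp add: dyadic_floor_def)
    then show "G ((y + real i) / real N) = G (real i / real N)" using G[OF 1] by simp
    have "2 ^ p * ((y + real i) / real N) = y + real i" using N by simp
    then show "(doubling ^^ p) ((y + real i) / real N) = y"
      unfolding doubling_funpow_eq_frac[OF 1] using that
      by (simp add: frac_unique_iff)
  qed
  have H': "has_bochner_integral unit_space H (\<integral>x. H x \<partial>unit_space)"
    using H by (simp add: has_bochner_integral_iff)
  have one: "has_bochner_integral unit_space (\<lambda>_. c) c" for c :: 'b
    using unit.prob_space by (auto simp: has_bochner_integral_iff)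
  have cong: "has_bochner_integral unit_space F i" if "\<And>y. y \<in> {0..<1} \<Longrightarrow> F y = F' y"
    "has_bochner_integral unit_space F' i" for F F' :: "real \<Rightarrow> 'b" and i
  proof -
    have "(\<lambda>x. indicator {0..<1} x *\<^sub>R F x) = (\<lambda>x. indicator {0..<1} x *\<^sub>R F' x)"
      using that(1) by (auto simp: indicator_def fun_eq_iff)
    then show ?thesis using that(2) by (simp add: has_bochner_integral_unit_space_Ico)
  qed
  have "has_bochner_integral unit_space G ((\<Sum>i<N. G (real i / real N)) /\<^sub>R real N)"
    by (rule has_bochner_integral_unit_space_split[OF N(1)], rule cong, rule *(2), assumption+, rule one)
  then have GI: "(\<integral>x. G x \<partial>unit_space) = (\<Sum>i<N. G (real i / real N)) /\<^sub>R real N"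
    by (rule has_bochner_integral_integral_eq)
  have "has_bochner_integral unit_space (\<lambda>x. G x * H ((doubling ^^ p) x))
      ((\<Sum>i<N. G (real i / real N) * (\<integral>x. H x \<partial>unit_space)) /\<^sub>R real N)"
  proof (rule has_bochner_integral_unit_space_split[OF N(1)])
    fix i assume i: "i < N"
    show "has_bochner_integral unit_space
        (\<lambda>y. G ((y + real i) / real N) * H ((doubling ^^ p) ((y + real i) / real N)))
        (G (real i / real N) * (\<integral>x. H x \<partial>unit_space))"
      by (rule cong[where F'="\<lambda>y. G (real i / real N) * H y"])
        (simp_all add: * i H' has_bochner_integral_mult_right)
  qed
  then show ?thesis unfolding GI by (simp add: sum_distrib_right)
qed

section \<open>Wasserstein convergence from characteristic functions\<close>

lemma wasserstein_dist_nonneg: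
  assumes "prob_space M" "prob_space N"
  shows "0 \<le> wasserstein_dist M X N Y"
proof -
  have "ereal ((\<integral>\<omega>. (\<lambda>_. 0::real) (X \<omega>) \<partial>M) - (\<integral>\<omega>. (\<lambda>_. 0::real) (Y \<omega>) \<partial>N)) \<le> wasserstein_dist M X N Y"
    unfolding wasserstein_dist_def by (rule SUP_upper) (auto simp: lipschitz_on_def)
  then show ?thesis by (simp add: zero_ereal_def)
qed

lemma integrable_lipschitz:
  fixes h :: "real \<Rightarrow> real"
  assumes "prob_space M" "integrable M X" "1-lipschitz_on UNIV h"
  shows "integrable M (\<lambda>x. h (X x))"
proof -
  interpret prob_space M by fact
  have h: "\<bar>h x - h 0\<bar> \<le> \<bar>x\<bar>" for x
    using lipschitz_onD[OF assms(3), of x 0] by (simp add: dist_real_def)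
  have [measurable]: "h \<in> borel_measurable borel"
    using lipschitz_on_continuous_on[OF assms(3)] by (rule borel_measurable_continuous_onI)
  have [measurable]: "X \<in> borel_measurable M" using assms by auto
  show ?thesis
  proof (rule Bochner_Integration.integrable_bound)
    show "integrable M (\<lambda>x. \<bar>h 0\<bar> + \<bar>X x\<bar>)" using assms by auto
    show "AE x in M. norm (h (X x)) \<le> norm (\<bar>h 0\<bar> + \<bar>X x\<bar>)"
    proof (rule AE_I2)
      show "norm (h (X x)) \<le> norm (\<bar>h 0\<bar> + \<bar>X x\<bar>)" for x
        using h[of "X x"] by simp
    qed
  qed simp
qed

text \<open>The easy half of Kantorovich duality: both expectations of a test function are taken on
  the coupling, where its increments are at most \<open>|X' - Y'|\<close>.\<close>

lemma wasserstein_dist_le_coupling: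
  assumes M: "prob_space M" "X \<in> borel_measurable M"
    and N: "prob_space N" "Y \<in> borel_measurable N"
    and \<Omega>: "prob_space \<Omega>" "integrable \<Omega> X'" "integrable \<Omega> Y'"
    and X: "distr M borel X = distr \<Omega> borel X'" and Y: "distr N borel Y = distr \<Omega> borel Y'"
  shows "wasserstein_dist M X N Y \<le> ereal (\<integral>\<omega>. \<bar>X' \<omega> - Y' \<omega>\<bar> \<partial>\<Omega>)"
  unfolding wasserstein_dist_def
proof (rule SUP_least)
  fix h :: "real \<Rightarrow> real" assume "h \<in> {h. 1-lipschitz_on UNIV h}"
  then have h: "1-lipschitz_on UNIV h" by simp
  then have [measurable]: "h \<in> borel_measurable borel"
    by (intro borel_measurable_continuous_onI lipschitz_on_continuous_on)
  have [measurable]: "X' \<in> borel_measurable \<Omega>" "Y' \<in> borel_measurable \<Omega>" using \<Omega> by auto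
  have "(\<integral>\<omega>. h (X \<omega>) \<partial>M) = (\<integral>x. h x \<partial>distr M borel X)"
    using M by (subst integral_distr) auto
  also have "\<dots> = (\<integral>\<omega>. h (X' \<omega>) \<partial>\<Omega>)"
    unfolding X by (subst integral_distr) auto
  finally have 1: "(\<integral>\<omega>. h (X \<omega>) \<partial>M) = (\<integral>\<omega>. h (X' \<omega>) \<partial>\<Omega>)" .
  have "(\<integral>\<omega>. h (Y \<omega>) \<partial>N) = (\<integral>x. h x \<partial>distr N borel Y)"
    using N by (subst integral_distr) auto
  also have "\<dots> = (\<integral>\<omega>. h (Y' \<omega>) \<partial>\<Omega>)"
    unfolding Y by (subst integral_distr) auto
  finally have 2: "(\<integral>\<omega>. h (Y \<omega>) \<partial>N) = (\<integral>\<omega>. h (Y' \<omega>) \<partial>\<Omega>)" .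
  note i = integrable_lipschitz[OF \<Omega>(1,2) h] integrable_lipschitz[OF \<Omega>(1,3) h]
  have "(\<integral>\<omega>. h (X' \<omega>) \<partial>\<Omega>) - (\<integral>\<omega>. h (Y' \<omega>) \<partial>\<Omega>) = (\<integral>\<omega>. h (X' \<omega>) - h (Y' \<omega>) \<partial>\<Omega>)"
    using i by simp
  also have "\<dots> \<le> (\<integral>\<omega>. \<bar>X' \<omega> - Y' \<omega>\<bar> \<partial>\<Omega>)"
  proof (rule integral_mono)
    show "h (X' \<omega>) - h (Y' \<omega>) \<le> \<bar>X' \<omega> - Y' \<omega>\<bar>" for \<omega>
      using lipschitz_onD[OF h, of "X' \<omega>" "Y' \<omega>"] by (simp add: dist_real_def)
  qed (use i \<Omega> in auto)
  finally show "ereal ((\<integral>\<omega>. h (X \<omega>) \<partial>M) - (\<integral>\<omega>. h (Y \<omega>) \<partial>N)) \<le> ereal (\<integral>\<omega>. \<bar>X' \<omega> - Y' \<omega>\<bar> \<partial>\<Omega>)"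
    by (simp add: 1 2)
qed

text \<open>Bounded second moments give uniform integrability: up to a level \<open>R\<close>
  dominated convergence applies, and beyond it \<open>|D n|\<close> is at most
  \<open>(D n)^2 / R\<close>.\<close>

lemma tendsto_integral_abs_of_bounded_second_moment:
  assumes "prob_space \<Omega>"
    and D: "\<And>n. integrable \<Omega> (\<lambda>\<omega>. (D n \<omega>)\<^sup>2)" "\<And>n. D n \<in> borel_measurable \<Omega>"
    and C: "\<And>n. (\<integral>\<omega>. (D n \<omega>)\<^sup>2 \<partial>\<Omega>) \<le> C"
    and lim: "\<And>\<omega>. \<omega> \<in> space \<Omega> \<Longrightarrow> (\<lambda>n. D n \<omega>) \<longlonglongrightarrow> (0::real)"
  shows "(\<lambda>n. \<integral>\<omega>. \<bar>D n \<omega>\<bar> \<partial>\<Omega>) \<longlonglongrightarrow> 0"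
proof (rule LIMSEQ_I)
  interpret prob_space \<Omega> by fact
  note [measurable] = D(2)
  fix e :: real assume e: "e > 0"
  have "0 \<le> (\<integral>\<omega>. (D 0 \<omega>)\<^sup>2 \<partial>\<Omega>)" by simp
  with C[of 0] have C0: "C \<ge> 0" by linarith
  \<comment> \<open>Makes the part beyond \<open>R\<close> contribute at most
    \<open>(C + 1) / R = e / 2\<close>; the added 1 keeps \<open>R\<close> positive when
    \<open>C = 0\<close>.\<close>
  define R where "R = 2 * (C + 1) / e"
  have R: "R > 0" using C0 e by (simp add: R_def add_pos_nonneg)
  have "(\<lambda>n. \<integral>\<omega>. min \<bar>D n \<omega>\<bar> R \<partial>\<Omega>) \<longlonglongrightarrow> (\<integral>\<omega>. 0 \<partial>\<Omega>)"
  proof (rule integral_dominated_convergence[where w="\<lambda>_. R"])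
    show "AE \<omega> in \<Omega>. (\<lambda>n. min \<bar>D n \<omega>\<bar> R) \<longlonglongrightarrow> 0"
    proof (rule AE_I2)
      fix \<omega> assume "\<omega> \<in> space \<Omega>"
      then have "(\<lambda>n. min \<bar>D n \<omega>\<bar> R) \<longlonglongrightarrow> min \<bar>0\<bar> R"
        by (intro tendsto_intros lim)
      then show "(\<lambda>n. min \<bar>D n \<omega>\<bar> R) \<longlonglongrightarrow> 0" using R by simp
    qed
  qed (use R in auto)
  then obtain n0 where n0: "\<And>n. n \<ge> n0 \<Longrightarrow> \<bar>\<integral>\<omega>. min \<bar>D n \<omega>\<bar> R \<partial>\<Omega>\<bar> < e / 2"
    using LIMSEQ_D[of _ 0 "e/2"] e by force
  have "norm ((\<integral>\<omega>. \<bar>D n \<omega>\<bar> \<partial>\<Omega>) - 0) < e" if "n \<ge> n0" for n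
  proof -
    have min: "integrable \<Omega> (\<lambda>\<omega>. min \<bar>D n \<omega>\<bar> R)"
      using R by (intro integrable_const_bound[where B=R]) auto
    have "(\<integral>\<omega>. \<bar>D n \<omega>\<bar> \<partial>\<Omega>) \<le> (\<integral>\<omega>. min \<bar>D n \<omega>\<bar> R + (D n \<omega>)\<^sup>2 / R \<partial>\<Omega>)"
    proof (rule integral_mono)
      show "integrable \<Omega> (\<lambda>\<omega>. \<bar>D n \<omega>\<bar>)"
        by (rule integrable_abs[OF square_integrable_imp_integrable[OF D(2,1)]])
      show "integrable \<Omega> (\<lambda>\<omega>. min \<bar>D n \<omega>\<bar> R + (D n \<omega>)\<^sup>2 / R)"
        using min D by auto
      show "\<bar>D n \<omega>\<bar> \<le> min \<bar>D n \<omega>\<bar> R + (D n \<omega>)\<^sup>2 / R" for \<omega>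
      proof (cases "\<bar>D n \<omega>\<bar> \<le> R")
        case False
        then have "\<bar>D n \<omega>\<bar> * R \<le> \<bar>D n \<omega>\<bar> * \<bar>D n \<omega>\<bar>" by (intro mult_left_mono) auto
        then have "\<bar>D n \<omega>\<bar> \<le> (D n \<omega>)\<^sup>2 / R"
          using R by (simp add: field_simps power2_eq_square)
        then show ?thesis using R by (simp add: min_def)
      qed (use R in auto)
    qed
    also have "\<dots> = (\<integral>\<omega>. min \<bar>D n \<omega>\<bar> R \<partial>\<Omega>) + (\<integral>\<omega>. (D n \<omega>)\<^sup>2 \<partial>\<Omega>) / R"
      using min D by simp
    also have "\<dots> < e / 2 + (C + 1) / R"
    proof (rule add_less_le_mono)
      show "(\<integral>\<omega>. min \<bar>D n \<omega>\<bar> R \<partial>\<Omega>) < e / 2" using n0[OF that] by simp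
      show "(\<integral>\<omega>. (D n \<omega>)\<^sup>2 \<partial>\<Omega>) / R \<le> (C + 1) / R"
        using C[of n] R by (intro divide_right_mono) auto
    qed
    also have "(C + 1) / R = e / 2" using C0 e by (simp add: R_def nonzero_divide_eq_eq add_nonneg_eq_0_iff)
    finally show ?thesis by simp
  qed
  then show "\<exists>no. \<forall>n\<ge>no. norm ((\<integral>\<omega>. \<bar>D n \<omega>\<bar> \<partial>\<Omega>) - 0) < e" by blast
qed

text \<open>Realising the weak convergence on one probability space (Skorohod) turns it into convergence of
  an explicit coupling, and the bounded second moments make that coupling converge in mean.\<close>

lemma wasserstein_tendsto_of_char:
  assumes M: "prob_space M" and W [measurable]: "\<And>n. W n \<in> borel_measurable M"
    and W2: "\<And>n. integrable M (\<lambda>x. (W n x)\<^sup>2)" "\<And>n. (\<integral>x. (W n x)\<^sup>2 \<partial>M) \<le> 1"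
    and char: "\<And>t. (\<lambda>n. \<integral>x. iexp (t * W n x) \<partial>M) \<longlonglongrightarrow> exp (- (t\<^sup>2) / 2)"
    and N: "prob_space N" and Z: "distributed N lborel Z std_normal_density"
  shows "(\<lambda>n. wasserstein_dist M (W n) N Z) \<longlonglongrightarrow> 0"
proof -
  interpret M: prob_space M by fact
  have rd: "real_distribution (distr M borel (W n))" for n
    by (rule M.real_distribution_distr) simp
  have "weak_conv_m (\<lambda>n. distr M borel (W n)) std_normal_distribution"
    using rd real_dist_normal_dist
  proof (rule levy_continuity)
    show "(\<lambda>n. char (distr M borel (W n)) t) \<longlonglongrightarrow> char std_normal_distribution t" for t
      using char[of t] by (simp add: char_def[of "distr M borel _"] integral_distr char_std_normal_distribution)
  qed
  from Skorohod[OF rd real_dist_normal_dist this]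
  obtain \<Omega> :: "real measure" and V Y where \<Omega>: "prob_space \<Omega>"
    and V [measurable]: "\<And>n. V n \<in> borel_measurable \<Omega>"
    and dV: "\<And>n. distr \<Omega> borel (V n) = distr M borel (W n)"
    and Y [measurable]: "Y \<in> borel_measurable \<Omega>"
    and dY: "distr \<Omega> borel Y = std_normal_distribution"
    and lim: "\<And>x. x \<in> space \<Omega> \<Longrightarrow> (\<lambda>n. V n x) \<longlonglongrightarrow> Y x"
    by force
  interpret \<Omega>: prob_space \<Omega> by fact
  have Zm [measurable]: "Z \<in> borel_measurable N"
    using distributed_measurable[OF Z] by simp
  have dZ: "distr N borel Z = distr \<Omega> borel Y"
    using distributed_distr_eq_density[OF Z] dY by (simp cong: distr_cong)
  have V2: "integrable \<Omega> (\<lambda>\<omega>. (V n \<omega>)\<^sup>2)" "(\<integral>\<omega>. (V n \<omega>)\<^sup>2 \<partial>\<Omega>) \<le> 1" for n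
  proof -
    have "integrable (distr M borel (W n)) (\<lambda>x. x\<^sup>2)"
      using W2 by (subst integrable_distr_eq) auto
    then show "integrable \<Omega> (\<lambda>\<omega>. (V n \<omega>)\<^sup>2)"
      unfolding dV[symmetric] by (subst (asm) integrable_distr_eq) auto
    have "(\<integral>x. x\<^sup>2 \<partial>distr M borel (W n)) \<le> 1"
      using W2 by (subst integral_distr) auto
    then show "(\<integral>\<omega>. (V n \<omega>)\<^sup>2 \<partial>\<Omega>) \<le> 1"
      unfolding dV[symmetric] by (subst (asm) integral_distr) auto
  qed
  have Y2: "integrable \<Omega> (\<lambda>\<omega>. (Y \<omega>)\<^sup>2)" "(\<integral>\<omega>. (Y \<omega>)\<^sup>2 \<partial>\<Omega>) = 1"
    using std_normal_distribution_even_moments[of 1] unfolding dY[symmetric]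
    by (auto simp: integrable_distr_eq integral_distr)
  define D where "D n \<omega> = V n \<omega> - Y \<omega>" for n \<omega>
  have Dm [measurable]: "D n \<in> borel_measurable \<Omega>" for n
    by (simp add: D_def[abs_def])
  have Dle: "(D n \<omega>)\<^sup>2 \<le> 2 * (V n \<omega>)\<^sup>2 + 2 * (Y \<omega>)\<^sup>2" for n \<omega>
    using sum_squares_bound[of "V n \<omega>" "- Y \<omega>"] by (simp add: D_def power2_diff)
  have D2: "integrable \<Omega> (\<lambda>\<omega>. (D n \<omega>)\<^sup>2)" for n
    by (rule Bochner_Integration.integrable_bound[where f="\<lambda>\<omega>. 2 * (V n \<omega>)\<^sup>2 + 2 * (Y \<omega>)\<^sup>2"])
      (use V2 Y2 Dle in auto)
  have D4: "(\<integral>\<omega>. (D n \<omega>)\<^sup>2 \<partial>\<Omega>) \<le> 4" for n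
  proof -
    have "(\<integral>\<omega>. (D n \<omega>)\<^sup>2 \<partial>\<Omega>) \<le> (\<integral>\<omega>. 2 * (V n \<omega>)\<^sup>2 + 2 * (Y \<omega>)\<^sup>2 \<partial>\<Omega>)"
      using D2 V2 Y2 Dle by (intro integral_mono) auto
    also have "\<dots> \<le> 4" using V2[of n] Y2 by simp
    finally show ?thesis .
  qed
  have "(\<lambda>n. \<integral>\<omega>. \<bar>D n \<omega>\<bar> \<partial>\<Omega>) \<longlonglongrightarrow> 0"
  proof (rule tendsto_integral_abs_of_bounded_second_moment[OF \<Omega> D2 Dm D4])
    show "(\<lambda>n. D n \<omega>) \<longlonglongrightarrow> 0" if "\<omega> \<in> space \<Omega>" for \<omega>
      using tendsto_diff[OF lim[OF that] tendsto_const[of "Y \<omega>"]] by (simp add: D_def)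
  qed
  then have "(\<lambda>n. ereal (\<integral>\<omega>. \<bar>D n \<omega>\<bar> \<partial>\<Omega>)) \<longlonglongrightarrow> 0"
    by (simp add: zero_ereal_def)
  then show ?thesis
  proof (rule tendsto_sandwich[OF always_eventually always_eventually tendsto_const, rotated 2])
    show "\<forall>n. 0 \<le> wasserstein_dist M (W n) N Z"
      using wasserstein_dist_nonneg[OF M N] by simp
    show "\<forall>n. wasserstein_dist M (W n) N Z \<le> ereal (\<integral>\<omega>. \<bar>D n \<omega>\<bar> \<partial>\<Omega>)"
      unfolding D_def
      by (intro allI wasserstein_dist_le_coupling M N \<Omega> W Zm dZ dV[symmetric])
        (rule \<Omega>.square_integrable_imp_integrable[OF V V2(1)]
          \<Omega>.square_integrable_imp_integrable[OF Y Y2(1)])+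
  qed
qed

section \<open>Independent blocks\<close>

lemma cmod_iexp [simp]: "cmod (iexp x) = 1"
  by (simp add: norm_exp_eq_Re)

lemma iexp_add: "iexp (x + y) = iexp x * iexp y"
  by (simp add: distrib_left exp_add)

lemma doubling_funpow_measurable [measurable]: "(doubling ^^ k) \<in> measurable unit_space unit_space"
  using measure_preserving.meas[OF doubling.funpow] .

text \<open>Independence is used only through the product formula for integrals: the first block
  depends on \<open>p\<close> digits, and the remaining sum is a function of the point reached after
  \<open>p\<close> doublings.\<close>

lemma char_birkhoff_dyadic:
  assumes G [measurable]: "G \<in> borel_measurable borel"
    and step: "\<And>x. x \<in> {0..<1} \<Longrightarrow> G x = G (dyadic_floor p x)"
  shows "(\<integral>x. iexp (s * (\<Sum>j<m. G (((doubling ^^ p) ^^ j) x))) \<partial>unit_space)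
    = (\<integral>x. iexp (s * G x) \<partial>unit_space) ^ m"
proof (induction m)
  case 0
  show ?case using unit.prob_space by simp
next
  case (Suc m)
  let ?\<tau> = "doubling ^^ p"
  define H where "H x = iexp (s * (\<Sum>j<m. G ((?\<tau> ^^ j) x)))" for x
  have [measurable]: "(\<lambda>x. G ((?\<tau> ^^ j) x)) \<in> borel_measurable unit_space" for j
    by (rule measurable_compose[OF measure_preserving.meas[OF measure_preserving.funpow[OF doubling.funpow]]
          borel_unit_space[OF G]])
  have "H \<in> borel_measurable unit_space" unfolding H_def by measurable
  then have H: "integrable unit_space H"
    by (rule unit.integrable_const_bound[where B=1, rotated]) (simp add: H_def)
  have "(\<integral>x. iexp (s * (\<Sum>j<Suc m. G ((?\<tau> ^^ j) x))) \<partial>unit_space)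
      = (\<integral>x. iexp (s * G x) * H (?\<tau> x) \<partial>unit_space)"
    unfolding sum.lessThan_Suc_shift H_def iexp_add[symmetric] by (simp add: funpow_swap1 distrib_left)
  also have "\<dots> = (\<integral>x. iexp (s * G x) \<partial>unit_space) * (\<integral>x. H x \<partial>unit_space)"
    by (intro has_bochner_integral_integral_eq integral_dyadic_mult_doubling H) (simp add: step[symmetric])
  finally show ?case using Suc by (simp add: H_def)
qed

text \<open>The upper estimate of \<open>exp (- u)\<close> combines \<open>exp u >= 1 + u\<close>
  with \<open>(1 - u + u^2) * (1 + u) = 1 + u^3 >= 1\<close>.\<close>

lemma abs_exp_minus_linear_le:
  assumes "u \<ge> (0::real)"
  shows "\<bar>(1 - u) - exp (- u)\<bar> \<le> u\<^sup>2"
proof -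
  have 1: "1 - u \<le> exp (- u)" using exp_ge_add_one_self[of "- u"] by simp
  have "exp (- u) * (1 + u) \<le> exp (- u) * exp u"
    using exp_ge_add_one_self[of u] by (intro mult_left_mono) auto
  also have "\<dots> = 1" by (simp flip: exp_add)
  also have "1 \<le> (1 - u + u\<^sup>2) * (1 + u)"
    using assms by (simp add: algebra_simps power2_eq_square)
  finally have "exp (- u) \<le> 1 - u + u\<^sup>2"
    using assms by (auto intro: mult_right_le_imp_le[of _ "1 + u"])
  with 1 show ?thesis by simp
qed

text \<open>Taylor expansion to second order, with the bound on \<open>G\<close> controlling the
  cubic remainder, followed by \<open>|z^m - w^m| <= m * |z - w|\<close> in the unit disc. The
  estimate is explicit because \<open>s\<close> and \<open>m\<close> will both vary with
  \<open>n\<close>.\<close>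

lemma (in prob_space) char_power_approx:
  assumes G [measurable]: "G \<in> borel_measurable M" and B: "\<And>x. x \<in> space M \<Longrightarrow> \<bar>G x\<bar> \<le> B"
    and mean: "(\<integral>x. G x \<partial>M) = 0"
  shows "cmod ((\<integral>x. iexp (s * G x) \<partial>M) ^ m - complex_of_real (exp (- (s\<^sup>2 * (\<integral>x. (G x)\<^sup>2 \<partial>M) / 2))) ^ m)
    \<le> real m * s\<^sup>2 * (\<bar>s\<bar> * B ^ 3 / 6 + s\<^sup>2 * (\<integral>x. (G x)\<^sup>2 \<partial>M)\<^sup>2 / 4)"
proof -
  define v where "v = (\<integral>x. (G x)\<^sup>2 \<partial>M)"
  have v: "v \<ge> 0" by (simp add: v_def)
  have sq: "sq_integrable M G"
    using B by (intro sq_integrable_bounded[where B=B]) (auto intro: finite_measure_axioms)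
  have Gi: "integrable M G" using sq by (intro sq_integrable_integrable) (auto intro: finite_measure_axioms)
  define \<phi> where "\<phi> = (\<integral>x. iexp (s * G x) \<partial>M)"
  have \<phi>: "\<phi> = char (distr M borel G) s"
    unfolding \<phi>_def char_def by (subst integral_distr) auto
  have "cmod (\<phi> - complex_of_real (1 - s\<^sup>2 * v / 2)) \<le> (s\<^sup>2 / 6) * expectation (\<lambda>x. min (6 * (G x)\<^sup>2) (\<bar>s\<bar> * \<bar>G x\<bar> ^ 3))"
    using char_approx3'[OF G Gi sq_integrable_square[OF sq] mean _ refl, of v s]
    by (simp add: \<phi> v_def mean)
  also have "\<dots> \<le> (s\<^sup>2 / 6) * (\<bar>s\<bar> * B ^ 3)"
  proof (rule mult_left_mono)
    have B0: "B \<ge> 0" using B not_empty by force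
    have b: "\<bar>G x\<bar> ^ 3 \<le> B ^ 3" if "x \<in> space M" for x
      using B[OF that] by (intro power_mono) auto
    have le: "min (6 * (G x)\<^sup>2) (\<bar>s\<bar> * \<bar>G x\<bar> ^ 3) \<le> \<bar>s\<bar> * B ^ 3" if "x \<in> space M" for x
      using b[OF that] by (intro min.coboundedI2 mult_left_mono) auto
    have "expectation (\<lambda>x. min (6 * (G x)\<^sup>2) (\<bar>s\<bar> * \<bar>G x\<bar> ^ 3)) \<le> expectation (\<lambda>x. \<bar>s\<bar> * B ^ 3)"
      using le B0 by (intro integral_mono integrable_const_bound[where B="\<bar>s\<bar> * B ^ 3"]) auto
    then show "expectation (\<lambda>x. min (6 * (G x)\<^sup>2) (\<bar>s\<bar> * \<bar>G x\<bar> ^ 3)) \<le> \<bar>s\<bar> * B ^ 3"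
      by (simp add: prob_space)
  qed simp
  finally have 1: "cmod (\<phi> - complex_of_real (1 - s\<^sup>2 * v / 2)) \<le> s\<^sup>2 * (\<bar>s\<bar> * B ^ 3 / 6)" by simp
  have "cmod (complex_of_real (1 - s\<^sup>2 * v / 2) - complex_of_real (exp (- (s\<^sup>2 * v / 2)))) = \<bar>(1 - s\<^sup>2 * v / 2) - exp (- (s\<^sup>2 * v / 2))\<bar>"
    unfolding of_real_diff[symmetric] by (rule norm_of_real)
  also have "\<dots> \<le> (s\<^sup>2 * v / 2)\<^sup>2"
    using v by (intro abs_exp_minus_linear_le) auto
  also have "\<dots> = s\<^sup>2 * (s\<^sup>2 * v\<^sup>2 / 4)" by (simp add: power2_eq_square)
  finally have 2: "cmod (complex_of_real (1 - s\<^sup>2 * v / 2) - complex_of_real (exp (- (s\<^sup>2 * v / 2)))) \<le> s\<^sup>2 * (s\<^sup>2 * v\<^sup>2 / 4)" .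
  have "cmod (\<phi> - complex_of_real (exp (- (s\<^sup>2 * v / 2)))) \<le> s\<^sup>2 * (\<bar>s\<bar> * B ^ 3 / 6) + s\<^sup>2 * (s\<^sup>2 * v\<^sup>2 / 4)"
    using norm_triangle_mono[OF 1 2] by simp
  also have "\<dots> = s\<^sup>2 * (\<bar>s\<bar> * B ^ 3 / 6 + s\<^sup>2 * v\<^sup>2 / 4)" by (simp add: distrib_left)
  finally have 3: "cmod (\<phi> - complex_of_real (exp (- (s\<^sup>2 * v / 2)))) \<le> s\<^sup>2 * (\<bar>s\<bar> * B ^ 3 / 6 + s\<^sup>2 * v\<^sup>2 / 4)" .
  have "cmod \<phi> \<le> 1"
    unfolding \<phi> by (intro real_distribution.cmod_char_le_1 real_distribution_distr) simp
  moreover have "cmod (complex_of_real (exp (- (s\<^sup>2 * v / 2)))) \<le> 1"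
    unfolding norm_of_real using v by simp
  ultimately have "cmod (\<phi> ^ m - complex_of_real (exp (- (s\<^sup>2 * v / 2))) ^ m)
      \<le> m * cmod (\<phi> - complex_of_real (exp (- (s\<^sup>2 * v / 2))))"
    by (rule norm_power_diff)
  also have "\<dots> \<le> m * (s\<^sup>2 * (\<bar>s\<bar> * B ^ 3 / 6 + s\<^sup>2 * v\<^sup>2 / 4))"
    using 3 by (intro mult_left_mono) auto
  finally show ?thesis unfolding \<phi>_def v_def by (simp add: mult.assoc)
qed

text \<open>In the application \<open>sd\<close> is the norming of the Birkhoff sums of
  \<open>f\<close>, not of the block sums, so it is tied to the number \<open>m n\<close> of blocks
  only through the limit \<open>c\<close>.\<close>

lemma char_birkhoff_dyadic_tendsto:
  assumes G [measurable]: "G \<in> borel_measurable borel" and B: "\<And>x. \<bar>G x\<bar> \<le> B"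
    and step: "\<And>x. x \<in> {0..<1} \<Longrightarrow> G x = G (dyadic_floor p x)"
    and mean: "(\<integral>x. G x \<partial>unit_space) = 0"
    and sd: "filterlim sd at_top sequentially"
    and m: "(\<lambda>n. real (m n) / (sd n)\<^sup>2) \<longlonglongrightarrow> c"
  shows "(\<lambda>n. \<integral>x. iexp (t * ((\<Sum>j<m n. G (((doubling ^^ p) ^^ j) x)) / sd n)) \<partial>unit_space)
    \<longlonglongrightarrow> exp (- (t\<^sup>2 * (c * (\<integral>x. (G x)\<^sup>2 \<partial>unit_space))) / 2)"
proof -
  define v where "v = (\<integral>x. (G x)\<^sup>2 \<partial>unit_space)"
  define s where "s n = t / sd n" for n
  define \<phi> where "\<phi> n = (\<integral>x. iexp (s n * G x) \<partial>unit_space) ^ m n" for n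
  have s0: "s \<longlonglongrightarrow> 0"
    unfolding s_def using sd by (intro tendsto_divide_0[OF tendsto_const] filterlim_at_top_imp_at_infinity)
  have ms: "(\<lambda>n. real (m n) * (s n)\<^sup>2) \<longlonglongrightarrow> t\<^sup>2 * c"
    using tendsto_mult_left[OF m, of "t\<^sup>2"] by (simp add: s_def power_divide mult.commute)
  have \<phi>_eq: "(\<integral>x. iexp (t * ((\<Sum>j<m n. G (((doubling ^^ p) ^^ j) x)) / sd n)) \<partial>unit_space) = \<phi> n" for n
    using char_birkhoff_dyadic[OF G step, where s="s n" and m="m n"] by (simp add: s_def \<phi>_def)
  \<comment> \<open>The comparison is with a power of the Gaussian of the same variance, not yet
    with the limit: \<open>m n * (s n)^2\<close> converges while the bracket in the bound tends to
    0.\<close>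
  have "(\<lambda>n. \<phi> n - complex_of_real (exp (- ((s n)\<^sup>2 * v / 2))) ^ m n) \<longlonglongrightarrow> 0"
  proof (rule Lim_null_comparison[OF always_eventually], intro allI)
    show "cmod (\<phi> n - complex_of_real (exp (- ((s n)\<^sup>2 * v / 2))) ^ m n)
        \<le> real (m n) * (s n)\<^sup>2 * (\<bar>s n\<bar> * B ^ 3 / 6 + (s n)\<^sup>2 * v\<^sup>2 / 4)" for n
      unfolding \<phi>_def v_def by (rule unit.char_power_approx) (use B mean in auto)
    have "(\<lambda>n. real (m n) * (s n)\<^sup>2 * (\<bar>s n\<bar> * B ^ 3 / 6 + (s n)\<^sup>2 * v\<^sup>2 / 4))
        \<longlonglongrightarrow> t\<^sup>2 * c * (\<bar>0\<bar> * B ^ 3 / 6 + 0\<^sup>2 * v\<^sup>2 / 4)"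
      by (intro tendsto_intros ms s0) auto
    then show "(\<lambda>n. real (m n) * (s n)\<^sup>2 * (\<bar>s n\<bar> * B ^ 3 / 6 + (s n)\<^sup>2 * v\<^sup>2 / 4)) \<longlonglongrightarrow> 0"
      by simp
  qed
  moreover have "(\<lambda>n. complex_of_real (exp (- (real (m n) * (s n)\<^sup>2 * v / 2)))) \<longlonglongrightarrow>
      complex_of_real (exp (- (t\<^sup>2 * c * v / 2)))"
    by (intro tendsto_intros ms) auto
  moreover have "complex_of_real (exp (- ((s n)\<^sup>2 * v / 2))) ^ m n
      = complex_of_real (exp (- (real (m n) * (s n)\<^sup>2 * v / 2)))" for n
    by (simp only: of_real_power[symmetric] exp_of_nat_mult[symmetric]) (simp add: mult.assoc)
  ultimately have "\<phi> \<longlonglongrightarrow> complex_of_real (exp (- (t\<^sup>2 * c * v / 2)))"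
    using tendsto_add[of "\<lambda>n. \<phi> n - complex_of_real (exp (- ((s n)\<^sup>2 * v / 2))) ^ m n" 0 sequentially
        "\<lambda>n. complex_of_real (exp (- (real (m n) * (s n)\<^sup>2 * v / 2)))"] by simp
  then show ?thesis unfolding \<phi>_eq v_def by (simp add: mult.assoc)
qed

text \<open>Correlations between blocks factor into means and vanish. The exact value identifies the
  variance of the limit law as a limit of second moments.\<close>

lemma integral_birkhoff_dyadic_square:
  assumes G [measurable]: "G \<in> borel_measurable borel" and B: "\<And>x. \<bar>G x\<bar> \<le> B"
    and step: "\<And>x. x \<in> {0..<1} \<Longrightarrow> G x = G (dyadic_floor p x)"
    and mean: "(\<integral>x. G x \<partial>unit_space) = 0"
  shows "(\<integral>x. (\<Sum>j<m. G (((doubling ^^ p) ^^ j) x))\<^sup>2 \<partial>unit_space)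
    = real m * (\<integral>x. (G x)\<^sup>2 \<partial>unit_space)"
proof (rule measure_preserving.birkhoff_square_orthogonal[OF doubling.funpow])
  show G2: "sq_integrable unit_space G"
    using B by (intro sq_integrable_bounded[where B=B] finite_measure_unit_space) auto
  fix j
  let ?H = "\<lambda>x. G (((doubling ^^ p) ^^ j) x)"
  have "integrable unit_space ?H"
    by (rule sq_integrable_integrable[OF finite_measure_unit_space
        measure_preserving.sq_integrable_funpow[OF doubling.funpow G2]])
  from has_bochner_integral_integral_eq[OF integral_dyadic_mult_doubling[where G=G and H="?H", OF step this]]
  show "(\<integral>x. G x * G (((doubling ^^ p) ^^ Suc j) x) \<partial>unit_space) = 0"
    by (simp add: mean funpow_swap1)
qed

section \<open>Trigonometric approximation\<close>

text \<open>The bound on the frequencies is carried along because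
  \<open>f - cos_poly a {1..L}\<close> is orthogonal to degree at most \<open>L\<close>. Constants
  are covered by \<open>m = 0\<close>.\<close>

inductive trig_poly :: "nat \<Rightarrow> (real \<Rightarrow> real) \<Rightarrow> bool" where
  cos: "m \<le> n \<Longrightarrow> trig_poly n (\<lambda>x. cos (2 * pi * real m * x))"
| sin: "m \<le> n \<Longrightarrow> trig_poly n (\<lambda>x. sin (2 * pi * real m * x))"
| add: "trig_poly n p \<Longrightarrow> trig_poly n q \<Longrightarrow> trig_poly n (\<lambda>x. p x + q x)"
| cmult: "trig_poly n p \<Longrightarrow> trig_poly n (\<lambda>x. c * p x)"

lemma trig_poly_mono:
  assumes "trig_poly n p" "n \<le> n'" shows "trig_poly n' p"
  using assms by (induction) (auto intro: trig_poly.intros)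

lemma trig_poly_const: "trig_poly n (\<lambda>x. c)"
  using trig_poly.cmult[OF trig_poly.cos[of 0 n], of c] by simp

lemma trig_poly_diff:
  assumes "trig_poly n p" "trig_poly n q"
  shows "trig_poly n (\<lambda>x. p x - q x)"
  using trig_poly.add[OF assms(1) trig_poly.cmult[OF assms(2), of "-1"]] by simp

lemma trig_poly_sum:
  assumes "\<And>i. i \<in> I \<Longrightarrow> trig_poly n (p i)"
  shows "trig_poly n (\<lambda>x. \<Sum>i\<in>I. p i x)"
  using assms
  by (induction I rule: infinite_finite_induct) (auto intro: trig_poly.add trig_poly_const)

text \<open>The product formulas produce the frequency \<open>k - m\<close>, which may be
  negative.\<close>

lemma trig_poly_cos_int:
  assumes "nat \<bar>j\<bar> \<le> n" shows "trig_poly n (\<lambda>x. cos (2 * pi * real_of_int j * x))"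
  using trig_poly.cos[OF assms] by (cases "j \<ge> 0") auto

lemma trig_poly_sin_int:
  assumes "nat \<bar>j\<bar> \<le> n" shows "trig_poly n (\<lambda>x. sin (2 * pi * real_of_int j * x))"
  using trig_poly.sin[OF assms] trig_poly.cmult[OF trig_poly.sin[OF assms], of "-1"]
  by (cases "j \<ge> 0") auto

lemma cos_mult_trig:
  "cos (2 * pi * real k * x) * cos (2 * pi * real m * x)
    = 1 / 2 * (cos (2 * pi * real_of_int (int k - int m) * x) + cos (2 * pi * real_of_int (int k + int m) * x))"
  unfolding cos_times_cos by (simp add: algebra_simps)

lemma trig_poly_mult_cos:
  assumes "trig_poly n p" "k \<le> n'"
  shows "trig_poly (n + n') (\<lambda>x. cos (2 * pi * real k * x) * p x)"
  using assms(1)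
proof induction
  case (cos m n)
  show ?case unfolding cos_mult_trig
    using cos assms(2) by (intro trig_poly.cmult trig_poly.add trig_poly_cos_int) auto
next
  case (sin m n)
  have "cos (2 * pi * real k * x) * sin (2 * pi * real m * x)
    = 1 / 2 * (sin (2 * pi * real_of_int (int k + int m) * x) - sin (2 * pi * real_of_int (int k - int m) * x))" for x
    unfolding cos_times_sin by (simp add: algebra_simps diff_divide_distrib)
  then show ?case
    using sin assms(2) by (simp only:) (intro trig_poly.cmult trig_poly_diff trig_poly_sin_int; auto)
next
  case (add n p q)
  then show ?case using trig_poly.add by (simp only: distrib_left)
next
  case (cmult n p c)
  then show ?case using trig_poly.cmult by (simp only: mult.left_commute[of _ c])
qed

lemma trig_poly_mult_sin:
  assumes "trig_poly n p" "k \<le> n'"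
  shows "trig_poly (n + n') (\<lambda>x. sin (2 * pi * real k * x) * p x)"
  using assms(1)
proof induction
  case (cos m n)
  have "sin (2 * pi * real k * x) * cos (2 * pi * real m * x)
    = 1 / 2 * (sin (2 * pi * real_of_int (int k + int m) * x) + sin (2 * pi * real_of_int (int k - int m) * x))" for x
    unfolding sin_times_cos by (simp add: algebra_simps)
  then show ?case
    using cos assms(2) by (simp only:) (intro trig_poly.cmult trig_poly.add trig_poly_sin_int; auto)
next
  case (sin m n)
  have "sin (2 * pi * real k * x) * sin (2 * pi * real m * x)
    = 1 / 2 * (cos (2 * pi * real_of_int (int k - int m) * x) - cos (2 * pi * real_of_int (int k + int m) * x))" for x
    unfolding sin_times_sin by (simp add: algebra_simps diff_divide_distrib)
  then show ?case
    using sin assms(2) by (simp only:) (intro trig_poly.cmult trig_poly_diff trig_poly_cos_int; auto)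
next
  case (add n p q)
  then show ?case using trig_poly.add by (simp only: distrib_left)
next
  case (cmult n p c)
  then show ?case using trig_poly.cmult by (simp only: mult.left_commute[of _ c])
qed

lemma trig_poly_mult:
  assumes "trig_poly n p" "trig_poly n' q"
  shows "trig_poly (n' + n) (\<lambda>x. p x * q x)"
  using assms
proof (induction)
  case (add n p1 p2)
  then show ?case using trig_poly.add by (simp only: distrib_right)
next
  case (cmult n p c)
  then show ?case using trig_poly.cmult by (simp only: mult.assoc)
qed (auto intro: trig_poly_mult_cos trig_poly_mult_sin)

text \<open>A real-linear map on the plane is determined by its values at 1 and \<open>\<i>\<close>,
  so on the circle it is a combination of one cosine and one sine; products are absorbed by
  \<open>trig_poly_mult\<close>.\<close>

lemma trig_poly_circle_polynomial:
  assumes "real_polynomial_function p"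
  shows "\<exists>n. trig_poly n (\<lambda>x. p (cis (2 * pi * x)))"
  using assms
proof induction
  case (linear f)
  then interpret bounded_linear f .
  have "f (cis (2 * pi * x)) = f 1 * cos (2 * pi * real 1 * x) + f \<i> * sin (2 * pi * real 1 * x)" for x
  proof -
    have "cis (2 * pi * x) = cos (2 * pi * x) *\<^sub>R 1 + sin (2 * pi * x) *\<^sub>R \<i>"
      by (simp add: complex_eq_iff)
    then show ?thesis by (simp add: add scaleR)
  qed
  moreover have "trig_poly 1 (\<lambda>x. f 1 * cos (2 * pi * real 1 * x) + f \<i> * sin (2 * pi * real 1 * x))"
    by (intro trig_poly.intros) auto
  ultimately show ?case by (auto simp only:)
next
  case (const c)
  show ?case using trig_poly_const by blast
next
  case (add f g)
  then obtain n m where "trig_poly n (\<lambda>x. f (cis (2 * pi * x)))" "trig_poly m (\<lambda>x. g (cis (2 * pi * x)))"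
    by blast
  then have "trig_poly (max n m) (\<lambda>x. f (cis (2 * pi * x)) + g (cis (2 * pi * x)))"
    by (intro trig_poly.add) (auto elim: trig_poly_mono)
  then show ?case by blast
next
  case (mult f g)
  then show ?case using trig_poly_mult by blast
qed

text \<open>That \<open>h\<close>, read on the circle through the argument, is continuous also where the argument jumps
  comes from the lemma on homotopic loops, applied to \<open>h\<close> and itself.\<close>

lemma trig_poly_dense_continuous:
  fixes h :: "real \<Rightarrow> real"
  assumes h: "continuous_on {0..1} h" "h 0 = h 1" and e: "e > 0"
  obtains n q where "trig_poly n q" "\<And>x. x \<in> {0..1} \<Longrightarrow> \<bar>h x - q x\<bar> < e"
proof -
  have "homotopic_loops UNIV h h"
    using h by (auto simp: homotopic_loops_refl path_def pathstart_def pathfinish_def)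
  then have "continuous_on (sphere 0 1) (h \<circ> (\<lambda>z. Arg2pi z / (2 * pi)))"
    using homotopic_loops_imp_homotopic_circlemaps homotopic_with_imp_continuous by metis
  then obtain p where p: "real_polynomial_function p"
    "\<And>z. z \<in> sphere (0::complex) 1 \<Longrightarrow> \<bar>(h \<circ> (\<lambda>z. Arg2pi z / (2 * pi))) z - p z\<bar> < e"
    using Stone_Weierstrass_real_polynomial_function[OF compact_sphere _ e] by metis
  obtain n where n: "trig_poly n (\<lambda>x. p (cis (2 * pi * x)))"
    using trig_poly_circle_polynomial[OF p(1)] by blast
  show ?thesis
  proof (rule that[OF n])
    fix x :: real assume x: "x \<in> {0..1}"
    have "h (Arg2pi (cis (2 * pi * x)) / (2 * pi)) = h x"
    \<comment> \<open>At \<open>x = 1\<close> the argument is 0 and not \<open>2 * pi\<close>; here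
      \<open>h 0 = h 1\<close> is used.\<close>
    proof (cases "x = 1")
      case True
      then show ?thesis using h(2) Arg2pi_of_real[of 1] by simp
    next
      case False
      then have "Arg2pi (cis (2 * pi * x)) = 2 * pi * x"
        using x by (intro Arg2pi_unique[of 1]) (auto simp: cis_conv_exp)
      then show ?thesis by simp
    qed
    then show "\<bar>h x - p (cis (2 * pi * x))\<bar> < e"
      using p(2)[of "cis (2 * pi * x)"] by simp
  qed
qed

lemma trig_poly_continuous:
  assumes "trig_poly n q" shows "continuous_on UNIV q"
  using assms by induction (auto intro!: continuous_intros)

lemma trig_poly_measurable: "trig_poly n q \<Longrightarrow> q \<in> borel_measurable borel"
  by (intro borel_measurable_continuous_onI trig_poly_continuous)

lemma trig_poly_bounded:
  assumes "trig_poly n q" shows "\<exists>B. \<forall>x. \<bar>q x\<bar> \<le> B"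
  using assms
proof induction
  case (add n p q)
  then show ?case by (meson abs_triangle_ineq add_mono order_trans)
next
  case (cmult n p c)
  then show ?case by (metis abs_ge_zero abs_mult mult_left_mono)
qed (auto intro!: exI[of _ 1])

lemma sq_integrable_trig_poly: "trig_poly n q \<Longrightarrow> sq_integrable unit_space q"
proof -
  assume q: "trig_poly n q"
  then obtain B where "\<And>x. \<bar>q x\<bar> \<le> B" using trig_poly_bounded by blast
  then show ?thesis
    by (intro sq_integrable_bounded[OF finite_measure_unit_space] borel_unit_space[OF trig_poly_measurable[OF q]])
qed

lemma trig_poly_dense_bounded:
  assumes g: "g \<in> borel_measurable unit_space" and B: "\<And>x. x \<in> {0..1} \<Longrightarrow> \<bar>g x\<bar> \<le> B" and e: "e > 0"
  obtains n q where "trig_poly n q" "(\<integral>x. (g x - q x)\<^sup>2 \<partial>unit_space) < e"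
proof -
  have B0: "B \<ge> 0" using B[of 0] by force
  have "g measurable_on {0..1}"
    using g by (subst measurable_on_iff_borel_measurable) auto
  then obtain N hs where N: "negligible N" and hs: "\<And>n. continuous_on UNIV (hs n)"
    and lim: "\<And>x. x \<notin> N \<Longrightarrow> (\<lambda>n. hs n x) \<longlonglongrightarrow> (if x \<in> {0..1} then g x else 0)"
    unfolding measurable_on_def by blast
  \<comment> \<open>Clipping at \<open>B\<close> supplies the dominating constant. The second factor
    vanishes at 0 and 1, so that the end values agree as the circle demands, and at each interior
    point it is eventually 1.\<close>
  define k where "k n x = max (- B) (min B (hs n x)) * min 1 (real n * (x * (1 - x)))" for n x
  have kc: "continuous_on UNIV (k n)" for n
    unfolding k_def by (intro continuous_intros hs)
  have km: "k n \<in> borel_measurable unit_space" for n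
    by (intro borel_unit_space borel_measurable_continuous_onI kc)
  have kB: "\<bar>k n x\<bar> \<le> B" if "x \<in> {0..1}" for n x
  proof -
    have "0 \<le> real n * (x * (1 - x))" using that by auto
    then have "\<bar>k n x\<bar> \<le> B * 1"
      unfolding k_def abs_mult using B0 by (intro mult_mono) auto
    then show ?thesis by simp
  qed
  have "(\<lambda>n. \<integral>x. (g x - k n x)\<^sup>2 \<partial>unit_space) \<longlonglongrightarrow> (\<integral>x. 0 \<partial>unit_space)"
  proof (rule integral_dominated_convergence[where w="\<lambda>_. (2 * B)\<^sup>2"])
    have "AE x in lebesgue. x \<notin> N \<union> {0, 1}"
      using N by (intro AE_not_in) (auto simp: negligible_iff_null_sets)
    then have "AE x in unit_space. x \<notin> N \<union> {0, 1}"
      by (subst AE_restrict_space_iff) auto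
    then show "AE x in unit_space. (\<lambda>n. (g x - k n x)\<^sup>2) \<longlonglongrightarrow> 0"
      using AE_space
    proof eventually_elim
      case (elim x)
      then have x: "x \<in> {0..1}" "0 < x * (1 - x)" "x \<notin> N" by auto
      have "(\<lambda>n. max (- B) (min B (hs n x))) \<longlonglongrightarrow> max (- B) (min B (g x))"
        using lim[OF x(3)] x(1) by (intro tendsto_intros) auto
      also have "max (- B) (min B (g x)) = g x" using B[OF x(1)] by (auto simp: abs_le_iff)
      finally have 1: "(\<lambda>n. max (- B) (min B (hs n x))) \<longlonglongrightarrow> g x" .
      have "filterlim (\<lambda>n. x * (1 - x) * real n) at_top sequentially"
        by (rule filterlim_tendsto_pos_mult_at_top[OF tendsto_const x(2) filterlim_real_sequentially])
      then have "eventually (\<lambda>n. 1 \<le> real n * (x * (1 - x))) sequentially"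
        by (simp add: filterlim_at_top mult.commute)
      then have "(\<lambda>n. min 1 (real n * (x * (1 - x)))) \<longlonglongrightarrow> 1"
        by (intro tendsto_eventually) (auto elim: eventually_mono)
      from tendsto_mult[OF 1 this] have "(\<lambda>n. k n x) \<longlonglongrightarrow> g x" by (simp add: k_def)
      then have "(\<lambda>n. (g x - k n x)\<^sup>2) \<longlonglongrightarrow> (g x - g x)\<^sup>2" by (intro tendsto_intros)
      then show ?case by simp
    qed
    show "AE x in unit_space. norm ((g x - k n x)\<^sup>2) \<le> (2 * B)\<^sup>2" for n
    proof (rule AE_I2)
      fix x assume "x \<in> space unit_space"
      then have "\<bar>g x - k n x\<bar> \<le> 2 * B" using B[of x] kB[of x n] by auto
      then have "\<bar>g x - k n x\<bar>\<^sup>2 \<le> (2 * B)\<^sup>2" by (intro power_mono) auto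
      then show "norm ((g x - k n x)\<^sup>2) \<le> (2 * B)\<^sup>2" by simp
    qed
  qed (use g km in auto)
  \<comment> \<open>Two errors of \<open>e / 4\<close> are allowed, since each is doubled when the
    square of their sum is split.\<close>
  then have "eventually (\<lambda>n. (\<integral>x. (g x - k n x)\<^sup>2 \<partial>unit_space) < e / 4) sequentially"
    using e by (intro order_tendstoD) auto
  then obtain n where n: "(\<integral>x. (g x - k n x)\<^sup>2 \<partial>unit_space) < e / 4"
    by (auto dest: eventually_happens)
  have "continuous_on {0..1} (k n)" using kc by (rule continuous_on_subset) auto
  moreover have "k n 0 = k n 1" by (simp add: k_def)
  moreover have "sqrt (e / 4) > 0" using e by simp
  ultimately obtain m q where q: "trig_poly m q" "\<And>x. x \<in> {0..1} \<Longrightarrow> \<bar>k n x - q x\<bar> < sqrt (e / 4)"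
    by (rule trig_poly_dense_continuous) blast
  have sqk: "sq_integrable unit_space (k n)"
    using kB km by (intro sq_integrable_bounded[OF finite_measure_unit_space, where B=B]) auto
  have sqg: "sq_integrable unit_space g"
    using B g by (intro sq_integrable_bounded[OF finite_measure_unit_space, where B=B]) auto
  note sq = sq_integrable_diff[OF sqg sqk] sq_integrable_diff[OF sqk sq_integrable_trig_poly[OF q(1)]]
  have "(\<integral>x. (k n x - q x)\<^sup>2 \<partial>unit_space) \<le> (\<integral>x. e / 4 \<partial>unit_space)"
  proof (rule integral_mono)
    fix x assume "x \<in> space unit_space"
    then have "\<bar>k n x - q x\<bar>\<^sup>2 \<le> (sqrt (e / 4))\<^sup>2" using q(2)[of x] by (intro power_mono) auto
    then show "(k n x - q x)\<^sup>2 \<le> e / 4" using e by simp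
  qed (use sq(2) in \<open>auto simp: sq_integrable_def\<close>)
  then have 2: "(\<integral>x. (k n x - q x)\<^sup>2 \<partial>unit_space) \<le> e / 4" using unit.prob_space by simp
  have "(\<integral>x. ((g x - k n x) + (k n x - q x))\<^sup>2 \<partial>unit_space) < e"
    using integral_square_add_le[OF sq] n 2 by linarith
  then show ?thesis using that[OF q(1)] by simp
qed

lemma trig_poly_dense:
  assumes g: "sq_integrable unit_space g" and e: "e > 0"
  obtains n q where "trig_poly n q" "(\<integral>x. (g x - q x)\<^sup>2 \<partial>unit_space) < e"
proof -
  define c where "c n x = max (- real n) (min (real n) (g x))" for n x
  have gm [measurable]: "g \<in> borel_measurable unit_space" using g by (rule sq_integrable_measurable)
  have cm [measurable]: "c n \<in> borel_measurable unit_space" for n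
    unfolding c_def by measurable
  have cB: "\<bar>c n x\<bar> \<le> real n" for n x by (auto simp: c_def)
  have "(\<lambda>n. \<integral>x. (g x - c n x)\<^sup>2 \<partial>unit_space) \<longlonglongrightarrow> (\<integral>x. 0 \<partial>unit_space)"
  proof (rule integral_dominated_convergence[where w="\<lambda>x. (g x)\<^sup>2"])
    show "AE x in unit_space. (\<lambda>n. (g x - c n x)\<^sup>2) \<longlonglongrightarrow> 0"
    proof (rule AE_I2)
      fix x
      obtain n0 where "\<bar>g x\<bar> \<le> real n0" using real_arch_simple by blast
      then have "eventually (\<lambda>n. (g x - c n x)\<^sup>2 = 0) sequentially"
        by (intro eventually_sequentiallyI[of n0]) (auto simp: c_def)
      then show "(\<lambda>n. (g x - c n x)\<^sup>2) \<longlonglongrightarrow> 0" by (rule tendsto_eventually)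
    qed
    show "AE x in unit_space. norm ((g x - c n x)\<^sup>2) \<le> (g x)\<^sup>2" for n
    proof (rule AE_I2)
      fix x
      have "\<bar>g x - c n x\<bar> \<le> \<bar>g x\<bar>" by (auto simp: c_def)
      then have "\<bar>g x - c n x\<bar>\<^sup>2 \<le> \<bar>g x\<bar>\<^sup>2" by (intro power_mono) auto
      then show "norm ((g x - c n x)\<^sup>2) \<le> (g x)\<^sup>2" by simp
    qed
  qed (use g in \<open>auto simp: sq_integrable_def\<close>)
  then have "eventually (\<lambda>n. (\<integral>x. (g x - c n x)\<^sup>2 \<partial>unit_space) < e / 4) sequentially"
    using e by (intro order_tendstoD) auto
  then obtain n where n: "(\<integral>x. (g x - c n x)\<^sup>2 \<partial>unit_space) < e / 4"
    by (auto dest: eventually_happens)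
  obtain m q where q: "trig_poly m q" "(\<integral>x. (c n x - q x)\<^sup>2 \<partial>unit_space) < e / 4"
    using trig_poly_dense_bounded[OF cm cB, of "e/4"] e by (metis zero_less_divide_iff zero_less_numeral)
  have sqc: "sq_integrable unit_space (c n)"
    using cB by (intro sq_integrable_bounded[OF finite_measure_unit_space, where B="real n"]) auto
  have "(\<integral>x. ((g x - c n x) + (c n x - q x))\<^sup>2 \<partial>unit_space) < e"
    using integral_square_add_le[OF sq_integrable_diff[OF g sqc]
        sq_integrable_diff[OF sqc sq_integrable_trig_poly[OF q(1)]]] n q(2) by linarith
  then show ?thesis using that[OF q(1)] by simp
qed

section \<open>Orthogonality relations and cosine partial sums\<close>

lemma integral_cos_int:
  "(\<integral>x. cos (2 * pi * real_of_int j * x) \<partial>unit_space) = (if j = 0 then 1 else 0)"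
proof (cases "j = 0")
  case False
  have "((\<lambda>x. cos (2 * pi * real_of_int j * x)) has_integral
      sin (2 * pi * real_of_int j * 1) / (2 * pi * real_of_int j) - sin (2 * pi * real_of_int j * 0) / (2 * pi * real_of_int j)) {0..1}"
    using False by (intro fundamental_theorem_of_calculus)
      (auto intro!: derivative_eq_intros simp flip: has_real_derivative_iff_has_vector_derivative)
  moreover have "sin (2 * pi * real_of_int j) = 0"
    using sin_integer_2pi[of "real_of_int j"] by simp
  ultimately have "integral {0..1} (\<lambda>x. cos (2 * pi * real_of_int j * x)) = 0"
    by (simp add: integral_unique)
  moreover have "integrable unit_space (\<lambda>x. cos (2 * pi * real_of_int j * x))"
    by (intro continuous_imp_integrable_real continuous_intros)
  ultimately show ?thesis using False by (simp add: lebesgue_integral_eq_integral)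
qed (use unit.prob_space in simp)

lemma integral_sin_int: "(\<integral>x. sin (2 * pi * real_of_int j * x) \<partial>unit_space) = 0"
proof (cases "j = 0")
  case False
  have "((\<lambda>x. sin (2 * pi * real_of_int j * x)) has_integral
      (- cos (2 * pi * real_of_int j * 1) / (2 * pi * real_of_int j)) - (- cos (2 * pi * real_of_int j * 0) / (2 * pi * real_of_int j))) {0..1}"
    using False by (intro fundamental_theorem_of_calculus)
      (auto intro!: derivative_eq_intros simp flip: has_real_derivative_iff_has_vector_derivative)
  moreover have "cos (2 * pi * real_of_int j) = 1"
    using cos_integer_2pi[of "real_of_int j"] by simp
  ultimately have "integral {0..1} (\<lambda>x. sin (2 * pi * real_of_int j * x)) = 0"
    by (simp add: integral_unique)
  moreover have "integrable unit_space (\<lambda>x. sin (2 * pi * real_of_int j * x))"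
    by (intro continuous_imp_integrable_real continuous_intros)
  ultimately show ?thesis by (simp add: lebesgue_integral_eq_integral)
qed simp

text \<open>\<open>m >= 1\<close> rules out \<open>k = m = 0\<close>, where the value is 1;
  \<open>k = 0\<close> is kept so that constants are covered.\<close>

lemma integral_cos_cos:
  assumes "m \<ge> 1"
  shows "(\<integral>x. cos (2 * pi * real k * x) * cos (2 * pi * real m * x) \<partial>unit_space) = (if k = m then 1 / 2 else 0)"
proof -
  have i: "integrable unit_space (\<lambda>x. cos (2 * pi * real_of_int j * x))" for j
    by (intro continuous_imp_integrable_real continuous_intros)
  show ?thesis
    unfolding cos_mult_trig integral_mult_right_zero
    using assms by (subst Bochner_Integration.integral_add[OF i i]) (auto simp: integral_cos_int simp del: of_int_add of_int_diff)
qed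

lemma integral_sin_cos:
  "(\<integral>x. sin (2 * pi * real k * x) * cos (2 * pi * real m * x) \<partial>unit_space) = 0"
proof -
  have i: "integrable unit_space (\<lambda>x. sin (2 * pi * real_of_int j * x))" for j
    by (intro continuous_imp_integrable_real continuous_intros)
  have eq: "sin (2 * pi * real k * x) * cos (2 * pi * real m * x)
    = 1 / 2 * (sin (2 * pi * real_of_int (int k + int m) * x) + sin (2 * pi * real_of_int (int k - int m) * x))" for x
    unfolding sin_times_cos by (simp add: algebra_simps)
  show ?thesis
    unfolding eq integral_mult_right_zero
    by (subst Bochner_Integration.integral_add[OF i i]) (simp add: integral_sin_int del: of_int_add of_int_diff)
qed

text \<open>The index set is arbitrary because both partial sums \<open>{1..L}\<close> and tail
  pieces \<open>{Suc K..<Suc L}\<close> occur.\<close>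

definition cos_poly :: "(nat \<Rightarrow> real) \<Rightarrow> nat set \<Rightarrow> real \<Rightarrow> real" where
  "cos_poly a A x = (\<Sum>m\<in>A. a m * cos (2 * pi * real m * x))"

lemma trig_poly_cos_poly: "A \<subseteq> {..n} \<Longrightarrow> trig_poly n (cos_poly a A)"
  unfolding cos_poly_def by (intro trig_poly_sum trig_poly.cmult trig_poly.cos) auto

lemma sq_integrable_cos_poly: "finite A \<Longrightarrow> sq_integrable unit_space (cos_poly a A)"
proof -
  assume "finite A"
  then obtain n where "A \<subseteq> {..n}" unfolding finite_nat_set_iff_bounded_le by auto
  then show ?thesis by (intro sq_integrable_trig_poly trig_poly_cos_poly)
qed

text \<open>Up to frequency \<open>L\<close> the function and its partial sum have the same Fourier
  coefficients; frequency 0 rests on the vanishing mean of \<open>f\<close>, the sines on its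
  vanishing sine coefficients.\<close>

lemma cos_poly_orthogonal:
  assumes f: "sq_integrable unit_space f" and s: "has_cosine_series f a" and q: "trig_poly L q"
  shows "(\<integral>x. (f x - cos_poly a {1..L} x) * q x \<partial>unit_space) = 0"
proof -
  define g where "g x = f x - cos_poly a {1..L} x" for x
  have sqP: "sq_integrable unit_space (cos_poly a {1..L})"
    by (rule sq_integrable_cos_poly) simp
  have sqg: "sq_integrable unit_space g"
    unfolding g_def by (intro sq_integrable_diff f sqP)
  have split: "(\<integral>x. g x * h x \<partial>unit_space) = (\<integral>x. f x * h x \<partial>unit_space)
      - (\<Sum>m\<in>{1..L}. a m * (\<integral>x. h x * cos (2 * pi * real m * x) \<partial>unit_space))"
    if h: "sq_integrable unit_space h" for h
  proof -
    have "(\<integral>x. g x * h x \<partial>unit_space)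
        = (\<integral>x. f x * h x \<partial>unit_space) - (\<integral>x. cos_poly a {1..L} x * h x \<partial>unit_space)"
      unfolding g_def left_diff_distrib
      by (intro Bochner_Integration.integral_diff sq_integrable_mult f sqP h)
    also have "(\<integral>x. cos_poly a {1..L} x * h x \<partial>unit_space)
        = (\<integral>x. (\<Sum>m\<in>{1..L}. a m * (h x * cos (2 * pi * real m * x))) \<partial>unit_space)"
      by (simp add: cos_poly_def sum_distrib_right sum_distrib_left mult_ac)
    also have "\<dots> = (\<Sum>m\<in>{1..L}. a m * (\<integral>x. h x * cos (2 * pi * real m * x) \<partial>unit_space))"
      by (subst Bochner_Integration.integral_sum)
        (auto intro!: integrable_mult_right sq_integrable_mult h sq_integrable_trig_poly[OF trig_poly.cos[OF order_refl]])
    finally show ?thesis .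
  qed
  have "(\<integral>x. g x * p x \<partial>unit_space) = 0" if "trig_poly n p" "n \<le> L" for n p
    using that
  proof induction
    case (cos k n)
    have "(\<Sum>m\<in>{1..L}. a m * (\<integral>x. cos (2 * pi * real k * x) * cos (2 * pi * real m * x) \<partial>unit_space))
        = (\<Sum>m\<in>{1..L}. if m = k then a m / 2 else 0)"
      by (intro sum.cong) (auto simp: integral_cos_cos)
    also have "\<dots> = (if k = 0 then 0 else a k / 2)"
      using cos by (auto simp: sum.delta)
    also have "\<dots> = (\<integral>x. f x * cos (2 * pi * real k * x) \<partial>unit_space)"
      using s by (auto simp: has_cosine_series_def)
    finally show ?case
      using split[OF sq_integrable_trig_poly[OF trig_poly.cos[OF order_refl]], of k] by simp
  next
    case (sin k n)
    have "(\<integral>x. f x * sin (2 * pi * real k * x) \<partial>unit_space) = 0"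
      using s by (cases "k = 0") (auto simp: has_cosine_series_def)
    then show ?case
      using split[OF sq_integrable_trig_poly[OF trig_poly.sin[OF order_refl]], of k]
      by (simp add: integral_sin_cos)
  next
    case (add n p q)
    then show ?case
      by (simp add: distrib_left sq_integrable_mult sqg sq_integrable_trig_poly)
  next
    case (cmult n p c)
    then show ?case by (simp add: mult.left_commute[of _ c])
  qed
  from this[OF q] show ?thesis by (simp add: g_def)
qed

text \<open>The partial sum is an orthogonal projection, so by Pythagoras it is at least as close to
  \<open>f\<close> as any trigonometric polynomial of degree at most \<open>L\<close>, and density
  supplies a close one.\<close>

lemma cos_poly_tendsto:
  assumes f: "sq_integrable unit_space f" and s: "has_cosine_series f a"
  shows "(\<lambda>L. \<integral>x. (f x - cos_poly a {1..L} x)\<^sup>2 \<partial>unit_space) \<longlonglongrightarrow> 0"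
proof (rule LIMSEQ_I)
  fix e :: real assume "e > 0"
  then obtain n q where q: "trig_poly n q" "(\<integral>x. (f x - q x)\<^sup>2 \<partial>unit_space) < e"
    using trig_poly_dense[OF f] by blast
  have "norm ((\<integral>x. (f x - cos_poly a {1..L} x)\<^sup>2 \<partial>unit_space) - 0) < e" if "L \<ge> n" for L
  proof -
    let ?P = "cos_poly a {1..L}"
    have d: "trig_poly L (\<lambda>x. ?P x - q x)"
      using trig_poly_mono[OF q(1) that] by (intro trig_poly_diff trig_poly_cos_poly) auto
    have sq: "sq_integrable unit_space (\<lambda>x. f x - ?P x)" "sq_integrable unit_space (\<lambda>x. ?P x - q x)"
      by (intro sq_integrable_diff f sq_integrable_cos_poly sq_integrable_trig_poly[OF d]; simp)+
    have "(\<integral>x. (f x - q x)\<^sup>2 \<partial>unit_space)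
        = (\<integral>x. (f x - ?P x)\<^sup>2 + (?P x - q x)\<^sup>2 + 2 * ((f x - ?P x) * (?P x - q x)) \<partial>unit_space)"
      by (intro Bochner_Integration.integral_cong) (auto simp: power2_eq_square algebra_simps)
    also have "\<dots> = (\<integral>x. (f x - ?P x)\<^sup>2 \<partial>unit_space) + (\<integral>x. (?P x - q x)\<^sup>2 \<partial>unit_space)"
      using sq_integrable_square[OF sq(1)] sq_integrable_square[OF sq(2)] sq_integrable_mult[OF sq]
        cos_poly_orthogonal[OF f s d] by simp
    finally have "(\<integral>x. (f x - ?P x)\<^sup>2 \<partial>unit_space) \<le> (\<integral>x. (f x - q x)\<^sup>2 \<partial>unit_space)" by simp
    then show ?thesis using q(2) by simp
  qed
  then show "\<exists>n0. \<forall>L\<ge>n0. norm ((\<integral>x. (f x - cos_poly a {1..L} x)\<^sup>2 \<partial>unit_space) - 0) < e" by blast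
qed

section \<open>Variance of Birkhoff sums of cosine polynomials\<close>

lemma cos_poly_periodic: "cos_poly a A (x + 1) = cos_poly a A x"
proof -
  have "cos (2 * pi * real m * (x + 1)) = cos (2 * pi * real m * x)" for m
  proof -
    have "2 * pi * real m * (x + 1) = 2 * pi * real m * x + 2 * pi * real_of_int (int m)"
      by (simp add: algebra_simps)
    then show ?thesis
      by (simp only: cos_add sin_int_2pin cos_int_2pin)
  qed
  then show ?thesis by (simp add: cos_poly_def)
qed

lemma abs_cos_diff_le: "\<bar>cos x - cos y\<bar> \<le> \<bar>x - (y::real)\<bar>"
proof -
  have "\<bar>cos x - cos y\<bar> = 2 * (\<bar>sin ((x + y) / 2)\<bar> * \<bar>sin ((y - x) / 2)\<bar>)"
    by (simp add: cos_diff_cos abs_mult)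
  also have "\<dots> \<le> 2 * (1 * \<bar>(y - x) / 2\<bar>)"
    by (intro mult_left_mono mult_mono abs_sin_x_le_abs_x) auto
  finally show ?thesis by (simp add: abs_minus_commute)
qed

lemma cos_poly_lipschitz:
  assumes "finite A"
  obtains \<Lambda> where "\<Lambda> \<ge> 0" "\<And>x y. \<bar>cos_poly a A x - cos_poly a A y\<bar> \<le> \<Lambda> * \<bar>x - y\<bar>"
proof (rule that)
  let ?\<Lambda> = "\<Sum>m\<in>A. \<bar>a m\<bar> * (2 * pi * real m)"
  show "?\<Lambda> \<ge> 0" by (intro sum_nonneg) auto
  show "\<bar>cos_poly a A x - cos_poly a A y\<bar> \<le> ?\<Lambda> * \<bar>x - y\<bar>" for x y
  proof -
    have "\<bar>cos_poly a A x - cos_poly a A y\<bar>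
        \<le> (\<Sum>m\<in>A. \<bar>a m * (cos (2 * pi * real m * x) - cos (2 * pi * real m * y))\<bar>)"
      by (simp add: cos_poly_def sum_subtractf[symmetric] right_diff_distrib[symmetric] sum_abs)
    also have "\<dots> \<le> (\<Sum>m\<in>A. \<bar>a m\<bar> * \<bar>2 * pi * real m * x - 2 * pi * real m * y\<bar>)"
      unfolding abs_mult by (intro sum_mono mult_left_mono abs_cos_diff_le[unfolded abs_mult]) auto
    also have "\<dots> = ?\<Lambda> * \<bar>x - y\<bar>"
      by (simp add: right_diff_distrib[symmetric] abs_mult sum_distrib_right mult.assoc)
    finally show ?thesis .
  qed
qed

text \<open>\<open>doubling ^^ j\<close> multiplies every frequency by \<open>2 ^ j\<close>, so
  orthogonality keeps only the pairs of \<open>2 ^ j * l\<close> with \<open>l\<close>; the mean of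
  a squared cosine is 1/2.\<close>

lemma integral_cos_poly_doubling:
  assumes A: "finite A" "0 \<notin> A"
  shows "(\<integral>x. cos_poly a A x * cos_poly a A ((doubling ^^ j) x) \<partial>unit_space)
    = (\<Sum>l\<in>A. if 2 ^ j * l \<in> A then a (2 ^ j * l) * a l / 2 else 0)"
proof -
  have i: "integrable unit_space (\<lambda>x. cos (2 * pi * real m * x) * cos (2 * pi * real l * x))" for m l
    by (intro continuous_imp_integrable_real continuous_intros)
  have "cos_poly a A ((doubling ^^ j) x) = (\<Sum>l\<in>A. a l * cos (2 * pi * real (2 ^ j * l) * x))" for x
    by (simp add: periodic_doubling_funpow[of "cos_poly a A", OF cos_poly_periodic])
      (simp add: cos_poly_def mult_ac)
  then have "cos_poly a A x * cos_poly a A ((doubling ^^ j) x)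
      = (\<Sum>m\<in>A. \<Sum>l\<in>A. a m * a l * (cos (2 * pi * real m * x) * cos (2 * pi * real (2 ^ j * l) * x)))" for x
    unfolding cos_poly_def[of a A x] by (simp add: sum_product mult_ac)
  then have "(\<integral>x. cos_poly a A x * cos_poly a A ((doubling ^^ j) x) \<partial>unit_space)
      = (\<Sum>m\<in>A. \<Sum>l\<in>A. a m * a l * (\<integral>x. cos (2 * pi * real m * x) * cos (2 * pi * real (2 ^ j * l) * x) \<partial>unit_space))"
    using i by (simp only: Bochner_Integration.integral_sum Bochner_Integration.integrable_sum
        integrable_mult_right integral_mult_right_zero)
  also have "\<dots> = (\<Sum>m\<in>A. \<Sum>l\<in>A. if m = 2 ^ j * l then a m * a l / 2 else 0)"
  proof (intro sum.cong refl)
    fix m l assume "l \<in> A"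
    then have "2 ^ j * l \<ge> 1" using A(2) by (cases "l = 0") auto
    then show "a m * a l * (\<integral>x. cos (2 * pi * real m * x) * cos (2 * pi * real (2 ^ j * l) * x) \<partial>unit_space)
        = (if m = 2 ^ j * l then a m * a l / 2 else 0)"
      by (subst integral_cos_cos) auto
  qed
  also have "\<dots> = (\<Sum>l\<in>A. \<Sum>m\<in>A. if m = 2 ^ j * l then a m * a l / 2 else 0)"
    by (rule sum.swap)
  also have "\<dots> = (\<Sum>l\<in>A. if 2 ^ j * l \<in> A then a (2 ^ j * l) * a l / 2 else 0)"
    using A(1) by (intro sum.cong refl) (simp add: sum.delta)
  finally show ?thesis .
qed

text \<open>The bounds on \<open>a (2 ^ j * l)\<close> and \<open>a l\<close> multiply to a
  geometric factor in \<open>j\<close> and a power of \<open>l\<close>. The sum of these powers is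
  small when \<open>A\<close> lies far out.\<close>

lemma cos_poly_correlation_bound:
  assumes A: "finite A" "0 \<notin> A" and M: "M > 0"
    and a: "\<And>m. m \<ge> 1 \<Longrightarrow> \<bar>a m\<bar> \<le> M / real m powr \<beta>"
  shows "\<bar>\<integral>x. cos_poly a A x * cos_poly a A ((doubling ^^ j) x) \<partial>unit_space\<bar>
    \<le> M\<^sup>2 / 2 * (\<Sum>l\<in>A. real l powr (- 2 * \<beta>)) * (2 powr (- \<beta>)) ^ j"
proof -
  have "\<bar>\<integral>x. cos_poly a A x * cos_poly a A ((doubling ^^ j) x) \<partial>unit_space\<bar>
    \<le> (\<Sum>l\<in>A. \<bar>if 2 ^ j * l \<in> A then a (2 ^ j * l) * a l / 2 else 0\<bar>)"
    unfolding integral_cos_poly_doubling[OF A] by (rule sum_abs)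
  also have "\<dots> \<le> (\<Sum>l\<in>A. M\<^sup>2 / 2 * real l powr (- 2 * \<beta>) * (2 powr (- \<beta>)) ^ j)"
  proof (rule sum_mono)
    fix l assume l: "l \<in> A"
    then have l1: "l \<ge> 1" using A(2) by (cases "l = 0") auto
    have "\<bar>a (2 ^ j * l)\<bar> * \<bar>a l\<bar> \<le> (M / real (2 ^ j * l) powr \<beta>) * (M / real l powr \<beta>)"
      using l1 M by (intro mult_mono a) auto
    also have "\<dots> = M\<^sup>2 * (real l powr (- 2 * \<beta>) * (2 powr (- \<beta>)) ^ j)"
    proof -
      have "real (2 ^ j * l) powr \<beta> = (2 powr \<beta>) ^ j * real l powr \<beta>"
        by (simp add: powr_mult powr_power mult.commute flip: powr_realpow powr_powr)
          (simp add: powr_powr powr_realpow[symmetric] mult.commute)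
      moreover have "real l powr (- 2 * \<beta>) = 1 / (real l powr \<beta> * real l powr \<beta>)"
        using l1 by (simp add: powr_minus powr_add[symmetric] field_simps)
      moreover have "(2 powr (- \<beta>)) ^ j = 1 / (2 powr \<beta>) ^ j"
        by (simp add: powr_minus power_inverse field_simps)
      ultimately show ?thesis by (simp add: power2_eq_square)
    qed
    finally have "\<bar>a (2 ^ j * l)\<bar> * \<bar>a l\<bar> / 2 \<le> M\<^sup>2 / 2 * real l powr (- 2 * \<beta>) * (2 powr (- \<beta>)) ^ j"
      by simp
    then show "\<bar>if 2 ^ j * l \<in> A then a (2 ^ j * l) * a l / 2 else 0\<bar>
        \<le> M\<^sup>2 / 2 * real l powr (- 2 * \<beta>) * (2 powr (- \<beta>)) ^ j"
      by (auto simp: abs_mult)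
  qed
  also have "\<dots> = M\<^sup>2 / 2 * (\<Sum>l\<in>A. real l powr (- 2 * \<beta>)) * (2 powr (- \<beta>)) ^ j"
    by (simp add: sum_distrib_left sum_distrib_right)
  finally show ?thesis .
qed

lemma birkhoff_cos_poly_bound:
  assumes A: "finite A" "0 \<notin> A" and M: "M > 0" and \<beta>: "\<beta> > 0"
    and a: "\<And>m. m \<ge> 1 \<Longrightarrow> \<bar>a m\<bar> \<le> M / real m powr \<beta>"
  shows "(\<integral>x. (birkhoff (cos_poly a A) n x)\<^sup>2 \<partial>unit_space)
    \<le> real n * (M\<^sup>2 * (\<Sum>l\<in>A. real l powr (- 2 * \<beta>)) / (1 - 2 powr (- \<beta>)))"
proof -
  have "2 powr (- \<beta>) < (1::real)" using \<beta> by (simp add: powr_less_one)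
  then show ?thesis
    using doubling.birkhoff_square_bound[OF sq_integrable_cos_poly[OF A(1)] _ _ _
        cos_poly_correlation_bound[OF A M a], of n]
    by (simp add: sum_nonneg)
qed

text \<open>With \<open>n\<close> fixed, the remainder beyond \<open>K\<close> splits into the
  remainder beyond \<open>L\<close> and the terms between. The first part vanishes as
  \<open>L\<close> grows, even with the factor \<open>n^2\<close>; the second is bounded linearly in
  \<open>n\<close>, uniformly in \<open>L\<close>.\<close>

lemma birkhoff_cos_tail_bound:
  assumes f: "sq_integrable unit_space f" and s: "has_cosine_series f a"
    and M: "M > 0" and \<beta>: "\<beta> > 1 / 2"
    and a: "\<And>m. m \<ge> 1 \<Longrightarrow> \<bar>a m\<bar> \<le> M / real m powr \<beta>" and e: "e > 0"
  obtains K where "\<And>n. (\<integral>x. (birkhoff (\<lambda>x. f x - cos_poly a {1..K} x) n x)\<^sup>2 \<partial>unit_space) \<le> real n * e"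
proof -
  define R where "R = 1 - 2 powr (- \<beta>)"
  have R: "R > 0" using \<beta> by (simp add: R_def powr_less_one)
  \<comment> \<open>Solves \<open>2 * M^2 * \<delta> / R = e\<close>; the 2 comes from splitting the
    square of a sum.\<close>
  define \<delta> where "\<delta> = e * R / (2 * M\<^sup>2)"
  have \<delta>: "\<delta> > 0" using e R M by (simp add: \<delta>_def)
  \<comment> \<open>Here \<open>\<beta> > 1 / 2\<close> enters, as
    \<open>- 2 * \<beta> < - 1\<close>.\<close>
  have "summable (\<lambda>l. real l powr (- 2 * \<beta>))"
    using \<beta> by (simp add: summable_real_powr_iff)
  then obtain K where K: "\<And>m n. m \<ge> K \<Longrightarrow> norm (\<Sum>l\<in>{m..<n}. real l powr (- 2 * \<beta>)) < \<delta>"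
    using \<delta> unfolding summable_Cauchy by blast
  have "(\<integral>x. (birkhoff (\<lambda>x. f x - cos_poly a {1..K} x) n x)\<^sup>2 \<partial>unit_space) \<le> real n * e" for n
  proof (rule LIMSEQ_le_const)
    let ?q = "\<lambda>L. \<integral>x. (f x - cos_poly a {1..L} x)\<^sup>2 \<partial>unit_space"
    have "(\<lambda>L. 2 * ((real n)\<^sup>2 * ?q L) + real n * e) \<longlonglongrightarrow> 2 * ((real n)\<^sup>2 * 0) + real n * e"
      by (intro tendsto_intros cos_poly_tendsto f s)
    then show "(\<lambda>L. 2 * ((real n)\<^sup>2 * ?q L) + real n * e) \<longlonglongrightarrow> real n * e" by simp
    have "(\<integral>x. (birkhoff (\<lambda>x. f x - cos_poly a {1..K} x) n x)\<^sup>2 \<partial>unit_space)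
        \<le> 2 * ((real n)\<^sup>2 * ?q L) + real n * e" if L: "L \<ge> K" for L
    proof -
      have P: "cos_poly a {1..L} x = cos_poly a {1..K} x + cos_poly a {Suc K..<Suc L} x" for x
        unfolding cos_poly_def using L
        by (subst sum.union_disjoint[symmetric]) (auto intro!: sum.cong)
      have sq: "sq_integrable unit_space (\<lambda>x. f x - cos_poly a {1..L} x)"
        by (intro sq_integrable_diff f sq_integrable_cos_poly) simp
      have sq': "sq_integrable unit_space (cos_poly a {Suc K..<Suc L})"
        by (intro sq_integrable_cos_poly) simp
      have "(\<integral>x. (birkhoff (\<lambda>x. f x - cos_poly a {1..K} x) n x)\<^sup>2 \<partial>unit_space)
          = (\<integral>x. (birkhoff (\<lambda>x. f x - cos_poly a {1..L} x) n x + birkhoff (cos_poly a {Suc K..<Suc L}) n x)\<^sup>2 \<partial>unit_space)"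
        unfolding P by (simp add: sum.distrib[symmetric])
      also have "\<dots> \<le> 2 * (\<integral>x. (birkhoff (\<lambda>x. f x - cos_poly a {1..L} x) n x)\<^sup>2 \<partial>unit_space)
          + 2 * (\<integral>x. (birkhoff (cos_poly a {Suc K..<Suc L}) n x)\<^sup>2 \<partial>unit_space)"
        by (intro integral_square_add_le doubling.sq_integrable_birkhoff sq sq')
      also have "\<dots> \<le> 2 * ((real n)\<^sup>2 * ?q L) + 2 * (real n * (M\<^sup>2 * \<delta> / R))"
      proof (intro add_mono mult_left_mono)
        show "(\<integral>x. (birkhoff (\<lambda>x. f x - cos_poly a {1..L} x) n x)\<^sup>2 \<partial>unit_space) \<le> (real n)\<^sup>2 * ?q L"
          by (rule doubling.birkhoff_square_trivial_bound[OF sq])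
        have "(\<integral>x. (birkhoff (cos_poly a {Suc K..<Suc L}) n x)\<^sup>2 \<partial>unit_space)
            \<le> real n * (M\<^sup>2 * (\<Sum>l\<in>{Suc K..<Suc L}. real l powr (- 2 * \<beta>)) / R)"
          unfolding R_def using \<beta> M a by (intro birkhoff_cos_poly_bound) auto
        also have "\<dots> \<le> real n * (M\<^sup>2 * \<delta> / R)"
          using K[of "Suc K" "Suc L"] R by (intro mult_left_mono divide_right_mono) auto
        finally show "(\<integral>x. (birkhoff (cos_poly a {Suc K..<Suc L}) n x)\<^sup>2 \<partial>unit_space)
            \<le> real n * (M\<^sup>2 * \<delta> / R)" .
      qed simp_all
      also have "2 * (real n * (M\<^sup>2 * \<delta> / R)) = real n * e"
        using M R by (simp add: \<delta>_def)
      finally show ?thesis .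
    qed
    then show "\<exists>N. \<forall>L\<ge>N. (\<integral>x. (birkhoff (\<lambda>x. f x - cos_poly a {1..K} x) n x)\<^sup>2 \<partial>unit_space)
        \<le> 2 * ((real n)\<^sup>2 * ?q L) + real n * e" by blast
  qed
  then show ?thesis by (rule that)
qed

lemma funpow_funpow_add: "(f ^^ i) (((f ^^ p) ^^ j) x) = (f ^^ (j * p + i)) x"
proof -
  have "(f ^^ (j * p + i)) x = (f ^^ (i + p * j)) x" by (simp add: add.commute mult.commute)
  also have "\<dots> = (f ^^ i) (((f ^^ p) ^^ j) x)" by (simp only: funpow_add funpow_mult o_apply)
  finally show ?thesis by simp
qed

text \<open>The block sums over \<open>p\<close> steps are replaced by their values at the left end points of the dyadic
  intervals of level \<open>p\<close>. The error is bounded independently of \<open>p\<close>, and its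
  correlations along the blocks decay geometrically.\<close>

lemma dyadic_block_approximation:
  fixes P :: "real \<Rightarrow> real"
  assumes per: "\<And>x. P (x + 1) = P x" and \<Lambda>: "\<Lambda> \<ge> 0" "\<And>x y. \<bar>P x - P y\<bar> \<le> \<Lambda> * \<bar>x - y\<bar>"
    and bdd: "\<And>x. \<bar>P x\<bar> \<le> B" and mean: "(\<integral>x. P x \<partial>unit_space) = 0" and p: "p \<ge> 1"
  obtains G C where "G \<in> borel_measurable borel" "\<And>x. \<bar>G x\<bar> \<le> C"
    "\<And>x. x \<in> {0..<1} \<Longrightarrow> G x = G (dyadic_floor p x)" "(\<integral>x. G x \<partial>unit_space) = 0"
    "\<And>m. (\<integral>x. (birkhoff P (m * p) x - (\<Sum>j<m. G (((doubling ^^ p) ^^ j) x)))\<^sup>2 \<partial>unit_space)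
      \<le> real m * (16 * \<Lambda>\<^sup>2)"
proof -
  let ?\<tau> = "doubling ^^ p"
  \<comment> \<open>Written with \<open>2 ^ i * x\<close> in place of the orbit of \<open>x\<close>:
    by periodicity this is the same Birkhoff sum, but it is Lipschitz in \<open>x\<close>, without
    the jumps of \<open>doubling\<close>.\<close>
  define Y where "Y x = (\<Sum>i<p. P (2 ^ i * x))" for x
  \<comment> \<open>Recentres the truncated block. The block itself has mean 0, so \<open>c\<close>
    is an average truncation error and \<open>|c| <= \<Lambda>\<close>.\<close>
  define c where "c = (\<integral>x. Y (dyadic_floor p x) \<partial>unit_space)"
  define G where "G x = Y (dyadic_floor p x) - c" for x
  define D where "D x = Y x - G x" for x
  have Pm [measurable]: "P \<in> borel_measurable borel"
  proof -
    have "\<Lambda>-lipschitz_on UNIV P" using \<Lambda> by (auto simp: lipschitz_on_def dist_real_def)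
    then show ?thesis by (intro borel_measurable_continuous_onI lipschitz_on_continuous_on)
  qed
  have Ym [measurable]: "Y \<in> borel_measurable borel" unfolding Y_def by measurable
  have Gm [measurable]: "G \<in> borel_measurable borel" unfolding G_def by measurable
  have Dm [measurable]: "D \<in> borel_measurable borel" unfolding D_def by measurable
  have intb: "integrable unit_space h" if "h \<in> borel_measurable borel" "\<And>x. \<bar>h x\<bar> \<le> b" for h :: "real \<Rightarrow> real" and b
    using that by (intro unit.integrable_const_bound[where B=b] borel_unit_space) auto
  have Yb: "\<bar>Y x\<bar> \<le> real p * B" for x
    unfolding Y_def using sum_bounded_above[of "{..<p}" "\<lambda>i. \<bar>P (2 ^ i * x)\<bar>" B] bdd
    by (intro order_trans[OF sum_abs]) simp
  have Y_doubling: "Y x = birkhoff P p x" for x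
    by (simp add: Y_def periodic_doubling_funpow[of P, OF per])
  have Yi: "integrable unit_space Y" "integrable unit_space (\<lambda>x. Y (dyadic_floor p x))"
    using Yb by (auto intro!: intb)
  have Y0: "(\<integral>x. Y x \<partial>unit_space) = 0"
  proof -
    have "integrable unit_space (\<lambda>x. P ((doubling ^^ i) x))" for i
      using bdd by (simp only: periodic_doubling_funpow[of P, OF per]) (intro intb; measurable)
    then have "(\<integral>x. Y x \<partial>unit_space) = (\<Sum>i<p. \<integral>x. P ((doubling ^^ i) x) \<partial>unit_space)"
      unfolding Y_doubling by (intro Bochner_Integration.integral_sum) auto
    also have "\<dots> = 0"
      by (subst doubling.integral_funpow[OF borel_unit_space[OF Pm]]) (simp add: mean)
    finally show ?thesis .
  qed
  \<comment> \<open>Truncation to \<open>q\<close> digits moves \<open>2 ^ i * x\<close> by at most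
    \<open>2 ^ i / 2 ^ q\<close>. Summed geometrically over \<open>i < p\<close>, this is
    independent of \<open>p\<close> when \<open>q = p\<close>.\<close>
  have Ydiff: "\<bar>Y x - Y (dyadic_floor q x)\<bar> \<le> \<Lambda> * (2 ^ p / 2 ^ q)" for x q
  proof -
    have dy: "\<bar>x - dyadic_floor q x\<bar> \<le> 1 / 2 ^ q"
      using dyadic_floor_le[of q x] dyadic_floor_ge[of x q] by simp
    have "\<bar>Y x - Y (dyadic_floor q x)\<bar> \<le> (\<Sum>i<p. \<bar>P (2 ^ i * x) - P (2 ^ i * dyadic_floor q x)\<bar>)"
      unfolding Y_def sum_subtractf[symmetric] by (rule sum_abs)
    also have "\<dots> \<le> (\<Sum>i<p. \<Lambda> * (2 ^ i * (1 / 2 ^ q)))"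
    proof (rule sum_mono)
      fix i
      have "\<bar>P (2 ^ i * x) - P (2 ^ i * dyadic_floor q x)\<bar> \<le> \<Lambda> * \<bar>2 ^ i * x - 2 ^ i * dyadic_floor q x\<bar>"
        by (rule \<Lambda>(2))
      also have "\<dots> = \<Lambda> * (2 ^ i * \<bar>x - dyadic_floor q x\<bar>)"
        by (simp add: right_diff_distrib[symmetric] abs_mult)
      also have "\<dots> \<le> \<Lambda> * (2 ^ i * (1 / 2 ^ q))"
        using dy \<Lambda>(1) by (intro mult_left_mono) auto
      finally show "\<bar>P (2 ^ i * x) - P (2 ^ i * dyadic_floor q x)\<bar> \<le> \<Lambda> * (2 ^ i * (1 / 2 ^ q))" .
    qed
    also have "\<dots> = \<Lambda> * ((\<Sum>i<p. 2 ^ i) / 2 ^ q)"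
      by (simp add: sum_distrib_left sum_divide_distrib)
    also have "\<dots> \<le> \<Lambda> * (2 ^ p / 2 ^ q)"
      using \<Lambda>(1) by (intro mult_left_mono divide_right_mono) (auto simp: geometric_sum)
    finally show ?thesis .
  qed
  have c: "\<bar>c\<bar> \<le> \<Lambda>"
  proof -
    have "\<bar>c\<bar> = \<bar>\<integral>x. Y (dyadic_floor p x) - Y x \<partial>unit_space\<bar>"
      using Yi Y0 by (simp add: c_def)
    also have "\<dots> \<le> (\<integral>x. \<bar>Y (dyadic_floor p x) - Y x\<bar> \<partial>unit_space)" by (rule integral_abs_bound)
    also have "\<dots> \<le> (\<integral>x. \<Lambda> \<partial>unit_space)"
      using Ydiff[of _ p] Yi by (intro integral_mono) (auto simp: abs_minus_commute)
    finally show ?thesis using unit.prob_space by simp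
  qed
  have Db: "\<bar>D x\<bar> \<le> 2 * \<Lambda>" for x
    using Ydiff[of x p] c by (simp add: D_def G_def)
  have Di: "integrable unit_space D" using Db by (intro intb) auto
  have Gi: "integrable unit_space G" and G0: "(\<integral>x. G x \<partial>unit_space) = 0"
    using Yi(2) unit.prob_space by (auto simp: G_def[abs_def] c_def)
  have D0: "(\<integral>x. D x \<partial>unit_space) = 0"
    using Yi(1) Gi Y0 G0 by (simp add: D_def[abs_def])
  have Dsq: "sq_integrable unit_space D"
    using Db by (intro sq_integrable_bounded[OF finite_measure_unit_space, where B="2 * \<Lambda>"] borel_unit_space) auto
  have corr: "\<bar>\<integral>x. D x * D ((?\<tau> ^^ j) x) \<partial>unit_space\<bar> \<le> 4 * \<Lambda>\<^sup>2 * (1 / 2) ^ j" for j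
  proof -
    \<comment> \<open>\<open>D\<close> truncated to the digits of the first \<open>j\<close> blocks
      is independent of the point reached after them, where \<open>D\<close> has mean 0. Only
      \<open>D - E\<close> contributes to the correlation.\<close>
    define E where "E x = D (dyadic_floor (p * j) x)" for x
    have DE: "\<bar>D x - E x\<bar> \<le> 2 * \<Lambda> * (1 / 2) ^ j" if j: "j \<ge> 1" for x
    proof -
      have "p \<le> p * j" using j by simp
      then have "D x - E x = Y x - Y (dyadic_floor (p * j) x)"
        by (simp add: D_def E_def G_def dyadic_floor_dyadic_floor)
      then have "\<bar>D x - E x\<bar> \<le> \<Lambda> * (2 ^ p / 2 ^ (p * j))" using Ydiff by simp
      also have "\<dots> \<le> \<Lambda> * (2 / 2 ^ j)"
      proof (intro mult_left_mono \<Lambda>(1))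
        \<comment> \<open>This is \<open>(p - 1) * (j - 1) >= 0\<close>.\<close>
        have "p + j \<le> p * j + 1"
          using j p by (cases p; cases j) auto
        then have "(2::real) ^ (p + j) \<le> 2 ^ (p * j + 1)" by (intro power_increasing) auto
        then show "(2::real) ^ p / 2 ^ (p * j) \<le> 2 / 2 ^ j"
          by (simp add: power_add divide_simps mult.commute)
      qed
      finally show ?thesis by (simp add: power_divide mult.commute)
    qed
    have meas: "(\<lambda>x. D ((?\<tau> ^^ j) x)) \<in> borel_measurable unit_space"
      by (rule sq_integrable_measurable[OF measure_preserving.sq_integrable_funpow[OF doubling.funpow Dsq]])
    have Em: "E \<in> borel_measurable unit_space"
      unfolding E_def by (intro borel_unit_space) measurable
    have Eb: "\<bar>E x\<bar> \<le> 2 * \<Lambda>" for x by (simp add: E_def Db)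
    show ?thesis
    proof (cases "j = 0")
      case True
      have "\<bar>\<integral>x. D x * D x \<partial>unit_space\<bar> \<le> (\<integral>x. (2 * \<Lambda>) * (2 * \<Lambda>) \<partial>unit_space)"
      proof (rule order_trans[OF integral_abs_bound], rule integral_mono)
        show "\<bar>D x * D x\<bar> \<le> (2 * \<Lambda>) * (2 * \<Lambda>)" for x
          unfolding abs_mult using Db \<Lambda>(1) by (intro mult_mono) auto
      qed (use sq_integrable_mult[OF Dsq Dsq] in auto)
      then show ?thesis using True unit.prob_space by (simp add: power2_eq_square)
    next
      case False
      have hb: "has_bochner_integral unit_space (\<lambda>x. E x * D ((doubling ^^ (p * j)) x))
          ((\<integral>x. E x \<partial>unit_space) * (\<integral>x. D x \<partial>unit_space))"
        by (rule integral_dyadic_mult_doubling[OF _ Di]) (simp add: E_def dyadic_floor_dyadic_floor)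
      have E0: "integrable unit_space (\<lambda>x. E x * D ((?\<tau> ^^ j) x))" "(\<integral>x. E x * D ((?\<tau> ^^ j) x) \<partial>unit_space) = 0"
        using hb by (auto simp: funpow_mult D0 has_bochner_integral_iff)
      have DDi: "integrable unit_space (\<lambda>x. D x * D ((?\<tau> ^^ j) x))"
        by (intro sq_integrable_mult Dsq measure_preserving.sq_integrable_funpow[OF doubling.funpow Dsq])
      have "\<bar>\<integral>x. D x * D ((?\<tau> ^^ j) x) \<partial>unit_space\<bar>
          = \<bar>\<integral>x. (D x - E x) * D ((?\<tau> ^^ j) x) \<partial>unit_space\<bar>"
        using DDi E0 by (simp add: left_diff_distrib)
      also have "\<dots> \<le> (\<integral>x. \<bar>(D x - E x) * D ((?\<tau> ^^ j) x)\<bar> \<partial>unit_space)"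
        by (rule integral_abs_bound)
      also have "\<dots> \<le> (\<integral>x. 2 * \<Lambda> * (1 / 2) ^ j * (2 * \<Lambda>) \<partial>unit_space)"
      proof (rule integral_mono)
        show "\<bar>(D x - E x) * D ((?\<tau> ^^ j) x)\<bar> \<le> 2 * \<Lambda> * (1 / 2) ^ j * (2 * \<Lambda>)" for x
          unfolding abs_mult using DE[of x] Db \<Lambda>(1) False by (intro mult_mono) auto
        show "integrable unit_space (\<lambda>x. \<bar>(D x - E x) * D ((?\<tau> ^^ j) x)\<bar>)"
          using Bochner_Integration.integrable_diff[OF DDi E0(1)]
          by (intro integrable_abs) (simp add: left_diff_distrib)
      qed simp
      also have "\<dots> = 4 * \<Lambda>\<^sup>2 * (1 / 2) ^ j"
        using unit.prob_space by (simp add: power2_eq_square)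
      finally show ?thesis .
    qed
  qed
  show ?thesis
  proof (rule that[OF Gm])
    show "\<bar>G x\<bar> \<le> real p * B + \<Lambda>" for x
      using Yb[of "dyadic_floor p x"] c by (simp add: G_def)
    show "G x = G (dyadic_floor p x)" for x
      by (simp add: G_def dyadic_floor_dyadic_floor)
    show "(\<integral>x. G x \<partial>unit_space) = 0" by (rule G0)
    fix m
    have "birkhoff P (m * p) x - (\<Sum>j<m. G ((?\<tau> ^^ j) x)) = (\<Sum>j<m. D ((?\<tau> ^^ j) x))" for x
    proof -
      have "(\<Sum>j<m. Y ((?\<tau> ^^ j) x)) = (\<Sum>j<m. \<Sum>i<p. P ((doubling ^^ (j * p + i)) x))"
        by (simp add: Y_doubling funpow_funpow_add)
      also have "\<dots> = (\<Sum>j<m. \<Sum>k\<in>{j * p..<j * p + p}. P ((doubling ^^ k) x))"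
        by (intro sum.cong refl sum.reindex_bij_witness[where i="\<lambda>k. k - j * p" and j="\<lambda>i. j * p + i" for j]) auto
      also have "\<dots> = birkhoff P (m * p) x" by (rule sum.nat_group)
      finally show ?thesis by (simp add: D_def sum_subtractf)
    qed
    \<comment> \<open>The constant is \<open>2 * C / (1 - r)\<close> for
      \<open>C = 4 * \<Lambda>^2\<close> and \<open>r = 1 / 2\<close>.\<close>
    then show "(\<integral>x. (birkhoff P (m * p) x - (\<Sum>j<m. G ((?\<tau> ^^ j) x)))\<^sup>2 \<partial>unit_space) \<le> real m * (16 * \<Lambda>\<^sup>2)"
      using measure_preserving.birkhoff_square_bound[OF doubling.funpow Dsq _ _ _ corr, of m] by simp
  qed
qed

section \<open>The central limit theorem\<close>

lemma cmod_iexp_diff_le: "cmod (iexp x - iexp y) \<le> \<bar>x - y\<bar>"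
proof -
  have "iexp x - iexp y = iexp y * (iexp (x - y) - 1)"
    using iexp_add[of y "x - y"] by (simp add: right_diff_distrib)
  then have "cmod (iexp x - iexp y) = cmod (iexp (x - y) - 1)"
    by (simp add: norm_mult)
  also have "\<dots> \<le> \<bar>x - y\<bar>"
    using iexp_approx1[of "x - y" 0] by simp
  finally show ?thesis .
qed

lemma abs_exp_minus_diff_le:
  assumes "u \<ge> 0" "w \<ge> (0::real)" shows "\<bar>exp (- u) - exp (- w)\<bar> \<le> \<bar>u - w\<bar>"
  using assms
proof (induction u w rule: linorder_wlog)
  case (le u w)
  have "exp (- w) = exp (- u) * exp (- (w - u))" by (simp flip: exp_add)
  then have "exp (- u) - exp (- w) = exp (- u) * (1 - exp (- (w - u)))" by (simp add: right_diff_distrib)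
  also have "\<dots> \<le> 1 * (w - u)"
  proof (intro mult_mono)
    show "1 - exp (- (w - u)) \<le> w - u" using exp_ge_add_one_self[of "- (w - u)"] by linarith
  qed (use le in auto)
  finally show ?case using le by simp
next
  case (sym u w)
  then show ?case by (simp add: abs_minus_commute)
qed

lemma (in prob_space) char_diff_le:
  assumes W: "sq_integrable M W" and V: "sq_integrable M V" and d: "\<delta> > 0"
    and D: "(\<integral>x. (W x - V x)\<^sup>2 \<partial>M) \<le> \<delta>\<^sup>2"
  shows "cmod ((\<integral>x. iexp (t * W x) \<partial>M) - (\<integral>x. iexp (t * V x) \<partial>M)) \<le> \<bar>t\<bar> * \<delta>"
proof -
  note [measurable] = sq_integrable_measurable[OF W] sq_integrable_measurable[OF V]
  note sq = sq_integrable_diff[OF W V]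
  have i: "integrable M (\<lambda>x. iexp (t * W x))" "integrable M (\<lambda>x. iexp (t * V x))"
    by (intro integrable_const_bound[where B=1]; simp)+
  have Di: "integrable M (\<lambda>x. \<bar>W x - V x\<bar>)"
    by (intro integrable_abs sq_integrable_integrable[OF finite_measure_axioms sq])
  have "cmod ((\<integral>x. iexp (t * W x) \<partial>M) - (\<integral>x. iexp (t * V x) \<partial>M))
      = cmod (\<integral>x. iexp (t * W x) - iexp (t * V x) \<partial>M)"
    using i by simp
  also have "\<dots> \<le> (\<integral>x. cmod (iexp (t * W x) - iexp (t * V x)) \<partial>M)"
    by (rule integral_norm_bound)
  also have "\<dots> \<le> (\<integral>x. \<bar>t\<bar> * \<bar>W x - V x\<bar> \<partial>M)"
  proof (rule integral_mono)
    show "cmod (iexp (t * W x) - iexp (t * V x)) \<le> \<bar>t\<bar> * \<bar>W x - V x\<bar>" for x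
      using cmod_iexp_diff_le[of "t * W x" "t * V x"] by (simp add: right_diff_distrib[symmetric] abs_mult)
  qed (use i Di in auto)
  also have "\<dots> = \<bar>t\<bar> * (\<integral>x. \<bar>W x - V x\<bar> \<partial>M)" by simp
  also have "\<dots> \<le> \<bar>t\<bar> * \<delta>"
  proof (rule mult_left_mono)
    have "(\<integral>x. \<bar>W x - V x\<bar> \<partial>M) \<le> (\<integral>x. \<delta> / 2 + (W x - V x)\<^sup>2 / (2 * \<delta>) \<partial>M)"
    proof (rule integral_mono)
      \<comment> \<open>A pointwise arithmetic-geometric mean inequality with weight
        \<open>\<delta>\<close> plays the part of Cauchy-Schwarz; its two halves add up to exactly
        \<open>\<delta>\<close>.\<close>
      show "\<bar>W x - V x\<bar> \<le> \<delta> / 2 + (W x - V x)\<^sup>2 / (2 * \<delta>)" for x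
        using sum_squares_bound[of \<delta> "\<bar>W x - V x\<bar>"] d
        by (simp add: field_simps power2_eq_square)
    qed (use Di sq_integrable_square[OF sq] in auto)
    also have "\<dots> = \<delta> / 2 + (\<integral>x. (W x - V x)\<^sup>2 \<partial>M) / (2 * \<delta>)"
      using sq_integrable_square[OF sq] by (simp add: prob_space)
    also have "\<dots> \<le> \<delta> / 2 + \<delta>\<^sup>2 / (2 * \<delta>)"
      using D d by (intro add_left_mono divide_right_mono) auto
    also have "\<dots> = \<delta>" using d by (simp add: power2_eq_square)
    finally show "(\<integral>x. \<bar>W x - V x\<bar> \<partial>M) \<le> \<delta>" .
  qed simp
  finally show ?thesis .
qed

text \<open>Young's inequality with weight \<open>\<delta>\<close> on the cross term keeps the error
  linear: \<open>\<delta> + (1 / \<delta> + 1) * \<delta>^2 = 2 * \<delta> +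
  \<delta>^2\<close>.\<close>

lemma second_moment_diff_le:
  assumes W: "sq_integrable M W" and V: "sq_integrable M V" and d: "0 < \<delta>" "\<delta> \<le> 1"
    and W1: "(\<integral>x. (W x)\<^sup>2 \<partial>M) = 1" and D: "(\<integral>x. (W x - V x)\<^sup>2 \<partial>M) \<le> \<delta>\<^sup>2"
  shows "\<bar>(\<integral>x. (V x)\<^sup>2 \<partial>M) - 1\<bar> \<le> 3 * \<delta>"
proof -
  note sq = sq_integrable_square[OF sq_integrable_diff[OF W V]] sq_integrable_square[OF W] sq_integrable_square[OF V]
  have le: "\<bar>(V x)\<^sup>2 - (W x)\<^sup>2\<bar> \<le> \<delta> * (W x)\<^sup>2 + (1 / \<delta> + 1) * (W x - V x)\<^sup>2" for x
  proof -
    define u where "u = W x - V x"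
    have "(V x)\<^sup>2 - (W x)\<^sup>2 = u\<^sup>2 - 2 * W x * u" by (simp add: u_def power2_eq_square algebra_simps)
    then have "\<bar>(V x)\<^sup>2 - (W x)\<^sup>2\<bar> \<le> u\<^sup>2 + 2 * \<bar>W x\<bar> * \<bar>u\<bar>"
      using abs_triangle_ineq4[of "u\<^sup>2" "2 * W x * u"] by (simp add: abs_mult)
    moreover have "2 * \<bar>W x\<bar> * \<bar>u\<bar> \<le> \<delta> * (W x)\<^sup>2 + u\<^sup>2 / \<delta>"
    proof -
      have "2 * (\<delta> * \<bar>W x\<bar>) * \<bar>u\<bar> \<le> (\<delta> * \<bar>W x\<bar>)\<^sup>2 + \<bar>u\<bar>\<^sup>2" by (rule sum_squares_bound)
      then have "\<delta> * (2 * \<bar>W x\<bar> * \<bar>u\<bar>) \<le> \<delta> * (\<delta> * (W x)\<^sup>2 + u\<^sup>2 / \<delta>)"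
        using d by (simp add: power_mult_distrib distrib_left power2_eq_square mult_ac)
      then show ?thesis using d by simp
    qed
    ultimately show ?thesis unfolding u_def[symmetric] by (simp add: field_simps)
  qed
  have "\<bar>(\<integral>x. (V x)\<^sup>2 \<partial>M) - 1\<bar> = \<bar>\<integral>x. (V x)\<^sup>2 - (W x)\<^sup>2 \<partial>M\<bar>"
    using sq W1 by simp
  also have "\<dots> \<le> (\<integral>x. \<bar>(V x)\<^sup>2 - (W x)\<^sup>2\<bar> \<partial>M)" by (rule integral_abs_bound)
  also have "\<dots> \<le> (\<integral>x. \<delta> * (W x)\<^sup>2 + (1 / \<delta> + 1) * (W x - V x)\<^sup>2 \<partial>M)"
    using le sq by (intro integral_mono) auto
  also have "\<dots> = \<delta> * 1 + (1 / \<delta> + 1) * (\<integral>x. (W x - V x)\<^sup>2 \<partial>M)"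
    using sq W1 by simp
  also have "\<dots> \<le> \<delta> * 1 + (1 / \<delta> + 1) * \<delta>\<^sup>2"
    using D d by (intro add_left_mono mult_left_mono) auto
  also have "\<dots> = 2 * \<delta> + \<delta> * \<delta>" using d by (simp add: field_simps power2_eq_square)
  also have "\<dots> \<le> 3 * \<delta>" using d mult_left_mono[of \<delta> 1 \<delta>] by simp
  finally show ?thesis .
qed

lemma div_over_tendsto:
  assumes p: "p \<ge> 1"
  shows "(\<lambda>n. real (n div p) / real n) \<longlonglongrightarrow> 1 / real p"
proof (rule tendsto_sandwich[OF _ _ _ tendsto_const])
  show "eventually (\<lambda>n. 1 / real p - 1 / real n \<le> real (n div p) / real n) sequentially"
  proof (rule eventually_sequentiallyI[of 1])
    fix n :: nat assume n: "n \<ge> 1"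
    have "n < (n div p + 1) * p" using p by (metis Suc_eq_plus1 dividend_less_div_times mult.commute not_one_le_zero zero_less_iff_neq_zero add.commute mult_Suc)
    then have "real n < (real (n div p) + 1) * real p" by (metis of_nat_1 of_nat_add of_nat_less_iff of_nat_mult)
    then have "real n / real p - 1 \<le> real (n div p)" using p by (simp add: field_simps)
    then have "(real n / real p - 1) / real n \<le> real (n div p) / real n" by (intro divide_right_mono) auto
    then show "1 / real p - 1 / real n \<le> real (n div p) / real n" using n by (simp add: diff_divide_distrib)
  qed
  show "eventually (\<lambda>n. real (n div p) / real n \<le> 1 / real p) sequentially"
  proof (rule eventually_sequentiallyI[of 1])
    fix n :: nat assume n: "n \<ge> 1"
    have "real (n div p) \<le> real n / real p" by (rule of_nat_div_le_of_nat)
    then have "real (n div p) / real n \<le> real n / real p / real n" by (intro divide_right_mono) auto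
    then show "real (n div p) / real n \<le> 1 / real p" using n by simp
  qed
  have "(\<lambda>n. 1 / real p - 1 / real n) \<longlonglongrightarrow> 1 / real p - 0"
    by (intro tendsto_intros lim_1_over_n)
  then show "(\<lambda>n. 1 / real p - 1 / real n) \<longlonglongrightarrow> 1 / real p" by simp
qed

lemma integral_cos_poly:
  assumes "0 \<notin> A" shows "(\<integral>x. cos_poly a A x \<partial>unit_space) = 0"
proof -
  have i: "integrable unit_space (\<lambda>x. cos (2 * pi * real m * x))" for m
    by (intro continuous_imp_integrable_real continuous_intros)
  have "(\<integral>x. cos (2 * pi * real m * x) \<partial>unit_space) = (if m = 0 then 1 else 0)" for m
    using integral_cos_int[of "int m"] by simp
  then show ?thesis
    unfolding cos_poly_def using assms
    by (subst Bochner_Integration.integral_sum) (auto simp: i intro!: sum.neutral)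
qed

lemma abs_cos_poly_le: "\<bar>cos_poly a A x\<bar> \<le> (\<Sum>m\<in>A. \<bar>a m\<bar>)"
proof -
  have "\<bar>cos_poly a A x\<bar> \<le> (\<Sum>m\<in>A. \<bar>a m * cos (2 * pi * real m * x)\<bar>)"
    unfolding cos_poly_def by (rule sum_abs)
  also have "\<dots> \<le> (\<Sum>m\<in>A. \<bar>a m\<bar>)"
    unfolding abs_mult by (intro sum_mono mult_left_le) auto
  finally show ?thesis .
qed

section \<open>The normal limit for a square integrable cosine series\<close>

locale doubling_clt =
  fixes f :: "real \<Rightarrow> real" and a :: "nat \<Rightarrow> real" and M \<beta> \<sigma> :: real and sd :: "nat \<Rightarrow> real"
  assumes f: "sq_integrable unit_space f" and series: "has_cosine_series f a"
    and M: "M > 0" and \<beta>: "\<beta> > 1 / 2"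
    and a: "\<And>m. m \<ge> 1 \<Longrightarrow> \<bar>a m\<bar> \<le> M / real m powr \<beta>"
    and lim: "(\<lambda>n. (sd n)\<^sup>2 / real n) \<longlonglongrightarrow> \<sigma>\<^sup>2" and \<sigma>: "\<sigma>\<^sup>2 > 0"
    and sd_nonneg: "\<And>n. sd n \<ge> 0"
    and sd: "\<And>n. (sd n)\<^sup>2 = (\<integral>x. (birkhoff f n x)\<^sup>2 \<partial>unit_space)"
begin

lemma lim_inverse: "(\<lambda>n. real n / (sd n)\<^sup>2) \<longlonglongrightarrow> 1 / \<sigma>\<^sup>2"
  using tendsto_inverse[OF lim] \<sigma> by (simp add: field_simps)

lemma sd_at_top: "filterlim sd at_top sequentially"
proof -
  have "filterlim (\<lambda>n. (sd n)\<^sup>2 / real n * real n) at_top sequentially"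
    by (rule filterlim_tendsto_pos_mult_at_top[OF lim \<sigma> filterlim_real_sequentially])
  then have "filterlim (\<lambda>n. (sd n)\<^sup>2) at_top sequentially"
    by (rule filterlim_mono_eventually[OF _ order_refl order_refl])
      (rule eventually_sequentiallyI[of 1], simp)
  then have "filterlim (\<lambda>n. sqrt ((sd n)\<^sup>2)) at_top sequentially"
    by (rule filterlim_compose[OF sqrt_at_top])
  then show ?thesis using sd_nonneg by simp
qed

lemma block_approximation:
  assumes e: "e > 0"
  obtains p G C where "p \<ge> 1" "G \<in> borel_measurable borel" "\<And>x. \<bar>G x\<bar> \<le> C"
    "\<And>x. x \<in> {0..<1} \<Longrightarrow> G x = G (dyadic_floor p x)" "(\<integral>x. G x \<partial>unit_space) = 0"
    "eventually (\<lambda>n. (\<integral>x. (birkhoff f n x / sd n - (\<Sum>j<n div p. G (((doubling ^^ p) ^^ j) x)) / sd n)\<^sup>2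
      \<partial>unit_space) \<le> e) sequentially"
proof -
  \<comment> \<open>The tail of the series enters as \<open>2 * e1 = e * \<sigma>^2 / 4\<close>. The
    choice of \<open>p\<close> grants the block error the same share, so the limit of the bound is
    at most \<open>e / 2\<close>.\<close>
  define e1 where "e1 = e * \<sigma>\<^sup>2 / 8"
  have e1: "e1 > 0" using e \<sigma> by (simp add: e1_def)
  obtain K where K: "\<And>n. (\<integral>x. (birkhoff (\<lambda>x. f x - cos_poly a {1..K} x) n x)\<^sup>2 \<partial>unit_space) \<le> real n * e1"
    using birkhoff_cos_tail_bound[OF f series M \<beta> a e1] by blast
  define P where "P = cos_poly a {1..K}"
  define B where "B = (\<Sum>m\<in>{1..K}. \<bar>a m\<bar>)"
  have B: "\<bar>P x\<bar> \<le> B" for x unfolding P_def B_def by (rule abs_cos_poly_le)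
  obtain \<Lambda> where \<Lambda>: "\<Lambda> \<ge> 0" "\<And>x y. \<bar>P x - P y\<bar> \<le> \<Lambda> * \<bar>x - y\<bar>"
    unfolding P_def by (rule cos_poly_lipschitz[of "{1..K}" a]) auto
  \<comment> \<open>\<open>p\<close> may be taken large after \<open>\<Lambda>\<close> is fixed: the
    error per block does not depend on \<open>p\<close>, and there are at most \<open>n / p\<close>
    blocks.\<close>
  obtain p :: nat where p: "64 * \<Lambda>\<^sup>2 / (e * \<sigma>\<^sup>2 / 4) < real p" using reals_Archimedean2 by blast
  have "0 \<le> 64 * \<Lambda>\<^sup>2 / (e * \<sigma>\<^sup>2 / 4)" using e by simp
  with p have "0 < real p" by linarith
  then have p1: "p \<ge> 1" by simp
  have p2: "64 * \<Lambda>\<^sup>2 / real p \<le> e * \<sigma>\<^sup>2 / 4" using p p1 e \<sigma> by (simp add: field_simps)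
  have mean: "(\<integral>x. P x \<partial>unit_space) = 0" unfolding P_def by (rule integral_cos_poly) simp
  have per: "P (x + 1) = P x" for x unfolding P_def by (rule cos_poly_periodic)
  obtain G C where G: "G \<in> borel_measurable borel" "\<And>x. \<bar>G x\<bar> \<le> C"
    "\<And>x. x \<in> {0..<1} \<Longrightarrow> G x = G (dyadic_floor p x)" "(\<integral>x. G x \<partial>unit_space) = 0"
    and Gm: "\<And>m. (\<integral>x. (birkhoff P (m * p) x - (\<Sum>j<m. G (((doubling ^^ p) ^^ j) x)))\<^sup>2 \<partial>unit_space)
      \<le> real m * (16 * \<Lambda>\<^sup>2)"
    by (rule dyadic_block_approximation[of P, OF per \<Lambda> B mean p1]) (rule that)
  have sqP: "sq_integrable unit_space P" unfolding P_def by (rule sq_integrable_cos_poly) simp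
  have sqG: "sq_integrable unit_space G"
    using G(2) by (intro sq_integrable_bounded[OF finite_measure_unit_space] borel_unit_space G(1))
  define V where "V n x = (\<Sum>j<n div p. G (((doubling ^^ p) ^^ j) x))" for n x
  have sqV: "sq_integrable unit_space (V n)" for n
    unfolding V_def by (rule measure_preserving.sq_integrable_birkhoff[OF doubling.funpow sqG])
  have bound: "(\<integral>x. (birkhoff f n x / sd n - V n x / sd n)\<^sup>2 \<partial>unit_space)
      \<le> (2 * e1 + 64 * \<Lambda>\<^sup>2 / real p) * (real n / (sd n)\<^sup>2) + 4 * (real p * B)\<^sup>2 * (1 / (sd n)\<^sup>2)" for n
  proof -
    define m where "m = n div p"
    \<comment> \<open>\<open>E1\<close> is the tail of the series, \<open>E2\<close> the fewer than
      \<open>p\<close> terms that fill no block, \<open>E3\<close> the passage to digit functions.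
      \<open>E2\<close> is bounded in \<open>n\<close> and disappears after division by
      \<open>(sd n)^2\<close>; the bounds for the other two are linear in \<open>n\<close>.\<close>
    define E1 where "E1 = birkhoff (\<lambda>x. f x - P x) n"
    define E2 where "E2 x = birkhoff P n x - birkhoff P (m * p) x" for x
    define E3 where "E3 x = birkhoff P (m * p) x - V n x" for x
    have s1: "sq_integrable unit_space E1"
      unfolding E1_def by (intro doubling.sq_integrable_birkhoff sq_integrable_diff f sqP)
    have s2: "sq_integrable unit_space E2"
      unfolding E2_def by (intro sq_integrable_diff doubling.sq_integrable_birkhoff sqP)
    have s3: "sq_integrable unit_space E3"
      unfolding E3_def by (intro sq_integrable_diff doubling.sq_integrable_birkhoff sqP sqV)
    have "birkhoff f n x - V n x = E1 x + (E2 x + E3 x)" for x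
      by (simp add: E1_def E2_def E3_def sum_subtractf)
    then have "(\<integral>x. (birkhoff f n x - V n x)\<^sup>2 \<partial>unit_space)
        \<le> 2 * (\<integral>x. (E1 x)\<^sup>2 \<partial>unit_space) + 2 * (\<integral>x. (E2 x + E3 x)\<^sup>2 \<partial>unit_space)"
      using integral_square_add_le[OF s1 sq_integrable_add[OF s2 s3]] by simp
    also have "\<dots> \<le> 2 * (real n * e1) + 2 * (2 * (real p * B)\<^sup>2 + 2 * (real n / real p * (16 * \<Lambda>\<^sup>2)))"
    proof (intro add_mono mult_left_mono)
      show "(\<integral>x. (E1 x)\<^sup>2 \<partial>unit_space) \<le> real n * e1"
        using K[of n] by (simp add: E1_def P_def)
      have "(\<integral>x. (E2 x + E3 x)\<^sup>2 \<partial>unit_space)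
          \<le> 2 * (\<integral>x. (E2 x)\<^sup>2 \<partial>unit_space) + 2 * (\<integral>x. (E3 x)\<^sup>2 \<partial>unit_space)"
        by (rule integral_square_add_le[OF s2 s3])
      also have "\<dots> \<le> 2 * (real p * B)\<^sup>2 + 2 * (real n / real p * (16 * \<Lambda>\<^sup>2))"
      proof (intro add_mono mult_left_mono)
        have "(\<integral>x. (E2 x)\<^sup>2 \<partial>unit_space) \<le> (\<integral>x. (real p * B)\<^sup>2 \<partial>unit_space)"
        proof (rule integral_mono)
          fix x
          have "{..<n} - {..<m * p} = {m * p..<n}" by auto
          moreover have mp: "m * p \<le> n" by (simp add: m_def)
          ultimately have "E2 x = (\<Sum>k\<in>{m * p..<n}. P ((doubling ^^ k) x))"
            unfolding E2_def by (subst sum_diff[symmetric]) auto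
          also have "\<bar>\<dots>\<bar> \<le> (\<Sum>k\<in>{m * p..<n}. B)"
            using B by (intro order_trans[OF sum_abs] sum_mono)
          also have "\<dots> = real (n - m * p) * B" by simp
          also have "\<dots> \<le> real p * B"
          proof (rule mult_right_mono)
            have "n - m * p = n mod p" by (simp add: m_def minus_div_mult_eq_mod)
            then show "real (n - m * p) \<le> real p" using p1 by (simp add: less_imp_le)
            show "B \<ge> 0" using B[of 0] by linarith
          qed
          finally have "\<bar>E2 x\<bar>\<^sup>2 \<le> (real p * B)\<^sup>2" by (intro power_mono) auto
          then show "(E2 x)\<^sup>2 \<le> (real p * B)\<^sup>2" by simp
        qed (use sq_integrable_square[OF s2] in auto)
        then show "(\<integral>x. (E2 x)\<^sup>2 \<partial>unit_space) \<le> (real p * B)\<^sup>2" using unit.prob_space by simp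
        have "(\<integral>x. (E3 x)\<^sup>2 \<partial>unit_space) \<le> real m * (16 * \<Lambda>\<^sup>2)"
          using Gm[of m] by (simp add: E3_def V_def m_def)
        also have "\<dots> \<le> real n / real p * (16 * \<Lambda>\<^sup>2)"
          unfolding m_def by (intro mult_right_mono of_nat_div_le_of_nat) auto
        finally show "(\<integral>x. (E3 x)\<^sup>2 \<partial>unit_space) \<le> real n / real p * (16 * \<Lambda>\<^sup>2)" .
      qed simp_all
      finally show "(\<integral>x. (E2 x + E3 x)\<^sup>2 \<partial>unit_space)
          \<le> 2 * (real p * B)\<^sup>2 + 2 * (real n / real p * (16 * \<Lambda>\<^sup>2))" .
    qed simp_all
    also have "\<dots> = (2 * e1 + 64 * \<Lambda>\<^sup>2 / real p) * real n + 4 * (real p * B)\<^sup>2"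
      by (simp add: algebra_simps)
    finally have "(\<integral>x. (birkhoff f n x - V n x)\<^sup>2 \<partial>unit_space) / (sd n)\<^sup>2
        \<le> ((2 * e1 + 64 * \<Lambda>\<^sup>2 / real p) * real n + 4 * (real p * B)\<^sup>2) / (sd n)\<^sup>2"
      by (intro divide_right_mono) auto
    then show ?thesis
      by (simp add: diff_divide_distrib[symmetric] power_divide add_divide_distrib)
  qed
  have "(\<lambda>n. (1 / sd n)\<^sup>2) \<longlonglongrightarrow> 0\<^sup>2"
    by (intro tendsto_power tendsto_divide_0[OF tendsto_const] filterlim_at_top_imp_at_infinity sd_at_top)
  then have "(\<lambda>n. 1 / (sd n)\<^sup>2) \<longlonglongrightarrow> 0" by (simp add: power_divide)
  then have "(\<lambda>n. (2 * e1 + 64 * \<Lambda>\<^sup>2 / real p) * (real n / (sd n)\<^sup>2) + 4 * (real p * B)\<^sup>2 * (1 / (sd n)\<^sup>2))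
      \<longlonglongrightarrow> (2 * e1 + 64 * \<Lambda>\<^sup>2 / real p) * (1 / \<sigma>\<^sup>2) + 4 * (real p * B)\<^sup>2 * 0"
    by (rule tendsto_add[OF tendsto_mult[OF tendsto_const lim_inverse] tendsto_mult[OF tendsto_const]])
  moreover have "(2 * e1 + 64 * \<Lambda>\<^sup>2 / real p) * (1 / \<sigma>\<^sup>2) + 4 * (real p * B)\<^sup>2 * 0 < e"
  proof -
    have "(2 * e1 + 64 * \<Lambda>\<^sup>2 / real p) * (1 / \<sigma>\<^sup>2) \<le> (2 * e1 + e * \<sigma>\<^sup>2 / 4) * (1 / \<sigma>\<^sup>2)"
      using p2 by (intro mult_right_mono add_left_mono) auto
    also have "\<dots> = e / 2" using \<sigma> by (simp add: e1_def field_simps)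
    also have "e / 2 < e" using e by simp
    finally show ?thesis by simp
  qed
  ultimately have "eventually (\<lambda>n. (2 * e1 + 64 * \<Lambda>\<^sup>2 / real p) * (real n / (sd n)\<^sup>2)
      + 4 * (real p * B)\<^sup>2 * (1 / (sd n)\<^sup>2) < e) sequentially"
    by (rule order_tendstoD(2))
  then have "eventually (\<lambda>n. (\<integral>x. (birkhoff f n x / sd n - V n x / sd n)\<^sup>2 \<partial>unit_space) \<le> e) sequentially"
  proof eventually_elim
    case (elim n)
    then show ?case using bound[of n] by linarith
  qed
  from that[of p G C, OF p1 G this[unfolded V_def]] show ?thesis .
qed

text \<open>The approximating normal law has a variance \<open>v\<close> of its own. It is within
  \<open>3 * \<delta>\<close> of 1, because the normalised sum eventually has second moment 1 and
  the block sum is close to it in L2.\<close>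

lemma char_tendsto:
  "(\<lambda>n. \<integral>x. iexp (t * (birkhoff f n x / sd n)) \<partial>unit_space) \<longlonglongrightarrow> exp (- (t\<^sup>2) / 2)"
proof (rule LIMSEQ_I)
  fix e :: real assume e: "e > 0"
  \<comment> \<open>The errors to come are \<open>|t| * \<delta>\<close> for blocks in place of
    \<open>f\<close>, \<open>\<delta>\<close> for the limit over blocks, and
    \<open>3 / 2 * t^2 * \<delta>\<close> for \<open>v\<close> in place of 1. The denominator leaves
    room for a strict inequality also at \<open>t = 0\<close>.\<close>
  define \<delta> where "\<delta> = min 1 (e / (\<bar>t\<bar> + 2 * t\<^sup>2 + 2))"
  have pos: "\<bar>t\<bar> + 2 * t\<^sup>2 + 2 > 0" by (smt (verit) zero_le_power2 abs_ge_zero)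
  have d: "\<delta> > 0" "\<delta> \<le> 1" using e pos by (auto simp: \<delta>_def)
  have "\<delta> * (\<bar>t\<bar> + 2 * t\<^sup>2 + 2) \<le> e / (\<bar>t\<bar> + 2 * t\<^sup>2 + 2) * (\<bar>t\<bar> + 2 * t\<^sup>2 + 2)"
    using pos by (intro mult_right_mono) (auto simp: \<delta>_def)
  also have "\<dots> = e" using pos by simp
  finally have de: "\<bar>t\<bar> * \<delta> + 2 * t\<^sup>2 * \<delta> + 2 * \<delta> \<le> e" by (simp add: algebra_simps)
  obtain p G C where p: "p \<ge> 1" and G: "G \<in> borel_measurable borel" "\<And>x. \<bar>G x\<bar> \<le> C"
    "\<And>x. x \<in> {0..<1} \<Longrightarrow> G x = G (dyadic_floor p x)" "(\<integral>x. G x \<partial>unit_space) = 0"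
    and ev: "eventually (\<lambda>n. (\<integral>x. (birkhoff f n x / sd n - (\<Sum>j<n div p. G (((doubling ^^ p) ^^ j) x)) / sd n)\<^sup>2
      \<partial>unit_space) \<le> \<delta>\<^sup>2) sequentially"
    by (rule block_approximation[OF zero_less_power[OF d(1), of 2]]) (rule that)
  define W where "W n x = birkhoff f n x / sd n" for n x
  define V where "V n x = (\<Sum>j<n div p. G (((doubling ^^ p) ^^ j) x)) / sd n" for n x
  define v where "v = 1 / real p * (1 / \<sigma>\<^sup>2) * (\<integral>x. (G x)\<^sup>2 \<partial>unit_space)"
  have v0: "v \<ge> 0" by (simp add: v_def)
  have sqG: "sq_integrable unit_space G"
    using G(2) by (intro sq_integrable_bounded[OF finite_measure_unit_space] borel_unit_space G(1))
  have sqW: "sq_integrable unit_space (W n)" for n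
    unfolding W_def by (intro sq_integrable_divide doubling.sq_integrable_birkhoff f)
  have sqV: "sq_integrable unit_space (V n)" for n
    unfolding V_def
    by (intro sq_integrable_divide measure_preserving.sq_integrable_birkhoff[OF doubling.funpow sqG])
  have m: "(\<lambda>n. real (n div p) / (sd n)\<^sup>2) \<longlonglongrightarrow> 1 / real p * (1 / \<sigma>\<^sup>2)"
  proof (rule Lim_transform_eventually[OF tendsto_mult[OF div_over_tendsto[OF p] lim_inverse]])
    show "eventually (\<lambda>n. real (n div p) / real n * (real n / (sd n)\<^sup>2) = real (n div p) / (sd n)\<^sup>2) sequentially"
      by (rule eventually_sequentiallyI[of 1]) simp
  qed
  have charV: "(\<lambda>n. \<integral>x. iexp (t * V n x) \<partial>unit_space) \<longlonglongrightarrow> exp (- (t\<^sup>2 * v) / 2)"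
    unfolding V_def v_def by (rule char_birkhoff_dyadic_tendsto[OF G sd_at_top m])
  have V2: "(\<integral>x. (V n x)\<^sup>2 \<partial>unit_space) = real (n div p) / (sd n)\<^sup>2 * (\<integral>x. (G x)\<^sup>2 \<partial>unit_space)" for n
    using integral_birkhoff_dyadic_square[OF G, of "n div p"] by (simp add: V_def power_divide)
  have limV2: "(\<lambda>n. \<integral>x. (V n x)\<^sup>2 \<partial>unit_space) \<longlonglongrightarrow> v"
    unfolding V2 v_def by (intro tendsto_mult m tendsto_const)
  have sdpos: "eventually (\<lambda>n. sd n > 0) sequentially"
    using sd_at_top by (simp add: filterlim_at_top_dense)
  have W1: "(\<integral>x. (W n x)\<^sup>2 \<partial>unit_space) = 1" if "sd n > 0" for n
    using that by (simp add: W_def power_divide sd[symmetric])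
  have "eventually (\<lambda>n. \<bar>(\<integral>x. (V n x)\<^sup>2 \<partial>unit_space) - 1\<bar> \<le> 3 * \<delta>) sequentially"
    using ev sdpos
  proof eventually_elim
    case (elim n)
    then show ?case
      by (intro second_moment_diff_le[OF sqW sqV d W1]) (auto simp: W_def V_def)
  qed
  then have v1: "\<bar>v - 1\<bar> \<le> 3 * \<delta>"
    by (intro tendsto_upperbound[OF tendsto_rabs[OF tendsto_diff[OF limV2 tendsto_const]]]) auto
  have 3: "cmod (complex_of_real (exp (- (t\<^sup>2 * v) / 2)) - complex_of_real (exp (- (t\<^sup>2) / 2))) \<le> 3 / 2 * t\<^sup>2 * \<delta>"
  proof -
    have "\<bar>exp (- (t\<^sup>2 * v / 2)) - exp (- (t\<^sup>2 / 2))\<bar> \<le> \<bar>t\<^sup>2 * v / 2 - t\<^sup>2 / 2\<bar>"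
      using v0 by (intro abs_exp_minus_diff_le) auto
    also have "t\<^sup>2 * v / 2 - t\<^sup>2 / 2 = t\<^sup>2 / 2 * (v - 1)" by (simp add: algebra_simps)
    also have "\<bar>\<dots>\<bar> \<le> t\<^sup>2 / 2 * (3 * \<delta>)" unfolding abs_mult using v1 by (intro mult_mono) auto
    finally have "\<bar>exp (- (t\<^sup>2 * v) / 2) - exp (- (t\<^sup>2) / 2)\<bar> \<le> 3 / 2 * t\<^sup>2 * \<delta>" by simp
    then show ?thesis unfolding of_real_diff[symmetric] norm_of_real .
  qed
  have "eventually (\<lambda>n. cmod ((\<integral>x. iexp (t * V n x) \<partial>unit_space) - exp (- (t\<^sup>2 * v) / 2)) < \<delta>) sequentially"
    using charV d(1) by (simp add: tendsto_iff dist_norm)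
  with ev have "eventually (\<lambda>n. cmod ((\<integral>x. iexp (t * W n x) \<partial>unit_space) - exp (- (t\<^sup>2) / 2)) < e) sequentially"
  proof eventually_elim
    case (elim n)
    have 1: "cmod ((\<integral>x. iexp (t * W n x) \<partial>unit_space) - (\<integral>x. iexp (t * V n x) \<partial>unit_space)) \<le> \<bar>t\<bar> * \<delta>"
      using elim(1) by (intro unit.char_diff_le sqW sqV d(1)) (auto simp: W_def V_def)
    note norm_triangle_mono[OF norm_triangle_mono[OF 1 less_imp_le[OF elim(2)]] 3]
    then have "cmod ((\<integral>x. iexp (t * W n x) \<partial>unit_space) - exp (- (t\<^sup>2) / 2)) \<le> \<bar>t\<bar> * \<delta> + \<delta> + 3 / 2 * t\<^sup>2 * \<delta>"
      by simp
    also have "\<dots> < \<bar>t\<bar> * \<delta> + 2 * t\<^sup>2 * \<delta> + 2 * \<delta>"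
    proof -
      have "t\<^sup>2 * \<delta> \<ge> 0" using d by simp
      then show ?thesis using d by linarith
    qed
    also have "\<dots> \<le> e" by (rule de)
    finally show ?case .
  qed
  then show "\<exists>n0. \<forall>n\<ge>n0. norm ((\<integral>x. iexp (t * (birkhoff f n x / sd n)) \<partial>unit_space) - exp (- (t\<^sup>2) / 2)) < e"
    by (simp add: eventually_sequentially W_def)
qed

end

section \<open>Return to the orbit variables\<close>

lemma orbit_sd_square:
  assumes "sq_integrable unit_space f" "(\<integral>x. f x \<partial>unit_space) = 0"
  shows "(orbit_sd f n)\<^sup>2 = (\<integral>x. (birkhoff f n x)\<^sup>2 \<partial>unit_space)"
proof -
  have "(\<integral>x. birkhoff f n x \<partial>unit_space) = (\<Sum>k<n. \<integral>x. f ((doubling ^^ k) x) \<partial>unit_space)"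
    by (intro Bochner_Integration.integral_sum sq_integrable_integrable[OF finite_measure_unit_space]
        doubling.sq_integrable_funpow assms)
  also have "\<dots> = 0"
    by (subst doubling.integral_funpow[OF sq_integrable_measurable[OF assms(1)]]) (simp add: assms)
  finally show ?thesis by (simp add: orbit_sd_def orbit_var_def)
qed

text \<open>The Bochner integral of a non-integrable function is \<open>0\<close>, so a positive \<open>orbit_sd\<close> says that
  the Birkhoff sum is square integrable; two consecutive sums then give \<open>f\<close> itself.\<close>

lemma sq_integrable_of_orbit_sd_pos:
  assumes f: "f \<in> borel_measurable unit_space" and pos: "orbit_sd f n > 0" "orbit_sd f (Suc n) > 0"
  shows "sq_integrable unit_space f"
proof -
  have fm [measurable]: "(\<lambda>x. f ((doubling ^^ k) x)) \<in> borel_measurable unit_space" for k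
    by (rule measurable_compose[OF doubling_funpow_measurable f])
  have S: "sq_integrable unit_space (birkhoff f k)" if "orbit_sd f k > 0" for k
  proof -
    let ?c = "\<integral>x. birkhoff f k x \<partial>unit_space"
    have "integrable unit_space (\<lambda>x. (birkhoff f k x - ?c)\<^sup>2)"
    proof (rule ccontr)
      assume "\<not> integrable unit_space (\<lambda>x. (birkhoff f k x - ?c)\<^sup>2)"
      then have "orbit_sd f k = 0" by (simp add: orbit_sd_def orbit_var_def not_integrable_integral_eq)
      then show False using that by simp
    qed
    then have "sq_integrable unit_space (\<lambda>x. birkhoff f k x - ?c)"
      by (intro sq_integrableI) measurable
    moreover have "sq_integrable unit_space (\<lambda>x. ?c)"
      by (rule sq_integrable_bounded[OF finite_measure_unit_space]) auto
    ultimately have "sq_integrable unit_space (\<lambda>x. (birkhoff f k x - ?c) + ?c)"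
      by (rule sq_integrable_add)
    then show ?thesis by simp
  qed
  have "sq_integrable unit_space (\<lambda>x. birkhoff f (Suc n) x - birkhoff f n x)"
    by (intro sq_integrable_diff S pos)
  then have "integrable unit_space (\<lambda>x. (f ((doubling ^^ n) x))\<^sup>2)"
    by (simp add: sq_integrable_def)
  then have "integrable unit_space (\<lambda>x. (f x)\<^sup>2)"
    using measure_preserving.integrable_comp[OF doubling.funpow[of n], of "\<lambda>x. (f x)\<^sup>2"] f by simp
  with f show ?thesis by (rule sq_integrableI)
qed

theorem theorem2p3:
  fixes f :: "real \<Rightarrow> real" and a :: "nat \<Rightarrow> real" and M \<beta> \<sigma> :: real
    and N :: "'b measure" and Z :: "'b \<Rightarrow> real"
  assumes "integrable unit_space f"
    and "\<not> (AE t in unit_space. f t = 0)"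
    and "has_cosine_series f a"
    and "\<beta> > 1 / 2"
    and "\<And>m. m \<ge> 1 \<Longrightarrow> \<bar>a m\<bar> < M / real m powr \<beta>"
    and "(\<lambda>n. (orbit_sd f n)\<^sup>2 / real n) \<longlonglongrightarrow> \<sigma>\<^sup>2"
    and "\<sigma>\<^sup>2 > 0"
    and "prob_space N"
    and "distributed N lborel Z std_normal_density"
  shows "(\<lambda>n. wasserstein_dist unit_space (orbit_normalized f n) N Z) \<longlonglongrightarrow> 0"
proof -
  have mean: "(\<integral>t. f t \<partial>unit_space) = 0"
    using assms(3) by (simp add: has_cosine_series_def)
  have nonneg: "orbit_sd f n \<ge> 0" for n by (simp add: orbit_sd_def)
  have "eventually (\<lambda>n. (orbit_sd f n)\<^sup>2 / real n > 0) sequentially"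
    using assms(6,7) by (rule order_tendstoD)
  then obtain n0 where n0: "\<And>n. n \<ge> n0 \<Longrightarrow> (orbit_sd f n)\<^sup>2 / real n > 0"
    by (auto simp: eventually_sequentially)
  have pos: "orbit_sd f n > 0" if "n \<ge> n0" for n
    using n0[OF that] nonneg[of n] by (cases "orbit_sd f n = 0") auto
  have f: "sq_integrable unit_space f"
    by (rule sq_integrable_of_orbit_sd_pos[of f n0]) (use assms(1) pos in auto)
  interpret doubling_clt f a M \<beta> \<sigma> "orbit_sd f"
  proof
    \<comment> \<open>From \<open>0 <= |a 1| < M\<close>.\<close>
    show "M > 0" using assms(5)[of 1] by simp
    show "\<bar>a m\<bar> \<le> M / real m powr \<beta>" if "m \<ge> 1" for m using assms(5)[OF that] by simp
    show "(orbit_sd f n)\<^sup>2 = (\<integral>x. (birkhoff f n x)\<^sup>2 \<partial>unit_space)" for n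
      by (rule orbit_sd_square[OF f mean])
  qed (use assms f nonneg in auto)
  \<comment> \<open>For \<open>n > 0\<close> the factor \<open>n\<close> cancels; for
    \<open>n = 0\<close> both sides are 0 by the convention on division by 0.\<close>
  have W: "orbit_normalized f n = (\<lambda>x. birkhoff f n x / orbit_sd f n)" for n
    using mean by (cases "n = 0")
      (auto simp: orbit_normalized_def orbit_avg_def orbit_mean_def orbit_var_def)
  have sqW: "sq_integrable unit_space (orbit_normalized f n)" for n
    unfolding W by (intro sq_integrable_divide doubling.sq_integrable_birkhoff f)
  show ?thesis
  proof (rule wasserstein_tendsto_of_char[OF prob_space_unit_space _ _ _ _ assms(8,9)])
    \<comment> \<open>The value is 1 unless \<open>orbit_sd f n = 0\<close>, when the quotient is 0
      by convention.\<close>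
    show "(\<integral>x. (orbit_normalized f n x)\<^sup>2 \<partial>unit_space) \<le> 1" for n
      unfolding W by (simp add: power_divide sd[symmetric])
    show "(\<lambda>n. \<integral>x. iexp (t * orbit_normalized f n x) \<partial>unit_space) \<longlonglongrightarrow> exp (- (t\<^sup>2) / 2)" for t
      unfolding W by (rule char_tendsto)
  qed (use sqW in \<open>auto simp: sq_integrable_def\<close>)
qed

end
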